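(* Let $(X,\mu)$ be a non-atomic probability space, let $\mathcal{T}$ be a tree on $X$ with associated maximal operator $\mathcal{M}_{\mathcal{T}}$, let $p>1$, let $f,F$ be real numbers with $0<f^p\le F$, and let $k\in(0,1)$. For $B\in[0,f]$ put $$h_k(B)=\frac{(f-B)^p}{(1-k)^{p-1}}+\frac{B^p}{k^{p-1}}.$$ Then $$B_p^{\mathcal{T}}(f,F,k)=\sup\left\{\left(F-\frac{(f-B)^p}{(1-k)^{p-1}}\right)\,\omega_p\!\left(\frac{B^p}{k^{p-1}\left(F-\frac{(f-B)^p}{(1-k)^{p-1}}\right)}\right)^{p} :\ B\in[0,f],\ h_k(B)\le F\right\},$$ where the expression inside the supremum is interpreted as $0$ if $F-\frac{(f-B)^p}{(1-k)^{p-1}}=0$ (which, under $h_k(B)\le F$, forces $B=0$).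
   Context: Let $(X,\mu)$ be a non-atomic probability space. A set $\mathcal{T}$ of measurable subsets of $X$ is called a tree if: (i) $X\in\mathcal{T}$ and $\mu(I)>0$ for every $I\in\mathcal{T}$; (ii) for every $I\in\mathcal{T}$ there corresponds a finite or countable subset $C(I)\subseteq\mathcal{T}$ containing at least two elements, whose elements are pairwise disjoint subsets of $I$ with $I=\bigcup C(I)$; (iii) $\mathcal{T}=\bigcup_{m\ge 0}\mathcal{T}_{(m)}$, where $\mathcal{T}_{(0)}=\{X\}$ and $\mathcal{T}_{(m+1)}=\bigcup_{I\in\mathcal{T}_{(m)}}C(I)$; (iv) $\lim_{m\to\infty}\sup_{I\in\mathcal{T}_{(m)}}\mu(I)=0$; (v) $\mathcal{T}$ differentiates $L^1(X,\mu)$, i.e. for every $\phi\in L^1(X,\mu)$, $\lim_{x\in I\in\mathcal{T},\,\mu(I)\to 0}\frac{1}{\mu(I)}\int_I\phi\,d\mu=\phi(x)$ for $\mu$-almost every $x\in X$. The associated maximal operator is $\mathcal{M}_{\mathcal{T}}\phi(x)=\sup\left\{\frac{1}{\mu(I)}\int_I|\phi|\,d\mu:\ x\in I\in\mathcal{T}\right\}$ for $\phi\in L^1(X,\mu)$, $x\in X$. For $p>1$, $0<f^p\le F$, $k\in(0,1]$, define $$B_p^{\mathcal{T}}(f,F,k)=\sup\left\{\int_K(\mathcal{M}_{\mathcal{T}}\phi)^p\,d\mu:\ \phi\ge 0\text{ measurable},\ \int_X\phi\,d\mu=f,\ \int_X\phi^p\,d\mu=F,\ K\subseteq X\text{ measurable},\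 \mu(K)=k\right\}.$$ The function $\omega_p:[0,1]\to\left[1,\frac{p}{p-1}\right]$ is the inverse of the (strictly decreasing, bijective) function $H_p:\left[1,\frac{p}{p-1}\right]\to[0,1]$, $H_p(z)=-(p-1)z^p+pz^{p-1}$. *)

theory Defs
  imports "HOL-Probability.Probability"
begin

definition nonatomic :: "'a measure \<Rightarrow> bool" where
  "nonatomic M \<longleftrightarrow>
     (\<forall>A\<in>sets M. emeasure M A > 0 \<longrightarrow>
        (\<exists>B\<in>sets M. B \<subseteq> A \<and> 0 < emeasure M B \<and> emeasure M B < emeasure M A))"

primrec tree_level :: "'a set \<Rightarrow> ('a set \<Rightarrow> 'a set set) \<Rightarrow> nat \<Rightarrow> 'a set set" where
  "tree_level X C 0 = {X}"
| "tree_level X C (Suc m) = (\<Union>I\<in>tree_level X C m. C I)"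

text \<open>The filter of tree elements \<open>I\<close> containing \<open>x\<close>, as the measure of \<open>I\<close> tends to \<open>0\<close>.\<close>

definition shrinking_to :: "'a measure \<Rightarrow> 'a set set \<Rightarrow> 'a \<Rightarrow> 'a set filter" where
  "shrinking_to M T x =
     inf (filtercomap (measure M) (at_right 0)) (principal {I \<in> T. x \<in> I})"

definition differentiates_L1 :: "'a measure \<Rightarrow> 'a set set \<Rightarrow> bool" where
  "differentiates_L1 M T \<longleftrightarrow>
     (\<forall>\<phi> :: 'a \<Rightarrow> real. integrable M \<phi> \<longrightarrow>
        (AE x in M. ((\<lambda>I. (1 / measure M I) * (LINT y:I|M. \<phi> y)) \<longlongrightarrow> \<phi> x)
                      (shrinking_to M T x)))"

definition is_tree :: "'a measure \<Rightarrow> 'a set set \<Rightarrow> bool" where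
  "is_tree M T \<longleftrightarrow>
     T \<subseteq> sets M \<and>
     space M \<in> T \<and> (\<forall>I\<in>T. measure M I > 0) \<and>
     (\<exists>C :: 'a set \<Rightarrow> 'a set set.
        (\<forall>I\<in>T. C I \<subseteq> T \<and> countable (C I) \<and> (\<exists>J\<in>C I. \<exists>J'\<in>C I. J \<noteq> J') \<and>
                disjoint (C I) \<and> (\<forall>J\<in>C I. J \<subseteq> I) \<and> I = \<Union>(C I)) \<and>
        T = (\<Union>m. tree_level (space M) C m) \<and>
        (\<lambda>m. SUP I\<in>tree_level (space M) C m. measure M I) \<longlonglongrightarrow> 0) \<and>
     differentiates_L1 M T"

text \<open>
  The supremum defining the maximal function may be infinite at some points, so it is
  taken in \<^typ>\<open>ennreal\<close>.
\<close>

definition tree_maximal :: "'a measure \<Rightarrow> 'a set set \<Rightarrow> ('a \<Rightarrow> real) \<Rightarrow> 'a \<Rightarrow> ennreal" where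
  "tree_maximal M T \<phi> x =
     (SUP I\<in>{I \<in> T. x \<in> I}. (\<integral>\<^sup>+y\<in>I. ennreal \<bar>\<phi> y\<bar> \<partial>M) / emeasure M I)"

text \<open>The power function on \<^typ>\<open>ennreal\<close>, intended for positive exponents.\<close>

definition ennreal_powr :: "ennreal \<Rightarrow> real \<Rightarrow> ennreal" where
  "ennreal_powr u p = (if u = \<top> then \<top> else ennreal (enn2real u powr p))"

definition Bellman ::
  "'a measure \<Rightarrow> 'a set set \<Rightarrow> real \<Rightarrow> real \<Rightarrow> real \<Rightarrow> real \<Rightarrow> ennreal" where
  "Bellman M T p f F k =
     Sup {(\<integral>\<^sup>+x\<in>K. ennreal_powr (tree_maximal M T \<phi> x) p \<partial>M) | \<phi> K.
            \<phi> \<in> borel_measurable M \<and> (\<forall>x\<in>space M. 0 \<le> \<phi> x) \<and>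
            (\<integral>\<^sup>+x. ennreal (\<phi> x) \<partial>M) = ennreal f \<and>
            (\<integral>\<^sup>+x. ennreal (\<phi> x powr p) \<partial>M) = ennreal F \<and>
            K \<in> sets M \<and> measure M K = k}"

definition H_fun :: "real \<Rightarrow> real \<Rightarrow> real" where
  "H_fun p z = - (p - 1) * z powr p + p * z powr (p - 1)"

definition omega_fun :: "real \<Rightarrow> real \<Rightarrow> real" where
  "omega_fun p = the_inv_into {1..p / (p - 1)} (H_fun p)"

definition h_fun :: "real \<Rightarrow> real \<Rightarrow> real \<Rightarrow> real \<Rightarrow> real" where
  "h_fun p f k B = (f - B) powr p / (1 - k) powr (p - 1) + B powr p / k powr (p - 1)"

definition candidate :: "real \<Rightarrow> real \<Rightarrow> real \<Rightarrow> real \<Rightarrow> real \<Rightarrow> real" where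
  "candidate p f F k B =
     (let A = F - (f - B) powr p / (1 - k) powr (p - 1)
      in if A = 0 then 0
         else A * omega_fun p (B powr p / (k powr (p - 1) * A)) powr p)"

end

theory Submission
  imports Defs
begin

text \<open>
  Upper bound: let \<open>N\<close> be the maximal function of \<open>\<phi>\<close>, and let \<open>K'\<close> be a set of measure \<open>k\<close> lying
  between \<open>{N > c}\<close> and \<open>{N \<ge> c}\<close>. The mean \<open>b\<close> of \<open>\<phi>\<close> over \<open>K'\<close> is at least \<open>c\<close>. For
  \<open>g = max N b\<close>, integrating the weak type inequality \<open>l \<mu>{N > l} \<le> \<integral>{N > l} \<phi>\<close> over \<open>l \<ge> b\<close> gives
  \<open>(p - 1) J + k b^p \<le> p \<integral>K' \<phi> g^(p-1)\<close> with \<open>J = \<integral>K' g^p\<close>, and \<open>J\<close> dominates \<open>\<integral>K N^p\<close> for every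
  \<open>K\<close> of measure \<open>k\<close>. By Hoelder's inequality this reads \<open>q \<le> H_p((J / A)^(1/p))\<close>, i.e.
  \<open>J \<le> A \<omega>_p(q)^p\<close>, where \<open>B = b k\<close>, \<open>q = B^p / (k^(p-1) A)\<close> and
  \<open>A = F - (f - B)^p / (1 - k)^(p-1)\<close> bounds \<open>\<integral>K' \<phi>^p\<close>.

  Lower bound: take \<open>K\<close> to be a disjoint union of tree sets and, iterating, inside each of the
  current sets a disjoint union of tree sets occupying the proportion \<open>1 - a\<close>. A function
  growing geometrically along these layers, and constant off \<open>K\<close>, satisfies \<open>N \<ge> r \<phi>\<close> on \<open>K\<close>, and
  as \<open>a \<rightarrow> 0\<close> the admissible \<open>r\<close> tend to \<open>\<omega>_p(q)\<close>.
\<close>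

section \<open>The functions H and omega\<close>

text \<open>Young's inequality for \<open>x\<close> and \<open>y powr (p - 1)\<close> with conjugate
  exponents \<open>p\<close> and \<open>p / (p - 1)\<close>, cleared of denominators. Integrated, it
  serves as Jensen's inequality and, after scaling \<open>x\<close>, as Hoelder's.\<close>

lemma powr_young:
  fixes p x y :: real
  assumes "p > 1" "x \<ge> 0" "y \<ge> 0"
  shows "p * x * y powr (p - 1) \<le> x powr p + (p - 1) * y powr p"
proof -
  have pq: "1 / p + 1 / (p / (p - 1)) = 1" using assms by (simp add: field_simps)
  have "x * y powr (p - 1) \<le> x powr p / p + (y powr (p - 1)) powr (p / (p - 1)) / (p / (p - 1))"
    by (rule Youngs_inequality) (use assms pq in \<open>auto simp: field_simps\<close>)
  also have "(y powr (p - 1)) powr (p / (p - 1)) = y powr p"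
    using assms by (simp add: powr_powr)
  finally have "p * (x * y powr (p - 1)) \<le> p * (x powr p / p + y powr p / (p / (p - 1)))"
    using assms by (intro mult_left_mono) auto
  also have "\<dots> = x powr p + (p - 1) * y powr p" using assms by (simp add: field_simps)
  finally show ?thesis by (simp add: mult.assoc)
qed

lemma H_fun_deriv:
  assumes "z > 0"
  shows "(H_fun p has_real_derivative p * (p - 1) * z powr (p - 2) * (1 - z)) (at z)"
proof -
  have "z powr (p - 1) = z * z powr (p - 2)"
    using assms powr_add[of z 1 "p - 2"] by simp
  then show ?thesis
    unfolding H_fun_def[abs_def]
    using assms by (auto intro!: derivative_eq_intros simp: algebra_simps)
qed

lemma H_fun_continuous_on: "1 \<le> y \<Longrightarrow> continuous_on {y..z} (H_fun p)"
  by (rule DERIV_continuous_on, rule has_field_derivative_at_within, rule H_fun_deriv) auto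

lemma H_fun_strict_antimono:
  assumes "p > 1" "1 \<le> y" "y < z"
  shows "H_fun p z < H_fun p y"
proof (rule DERIV_neg_imp_decreasing_open[OF assms(3)])
  fix x assume "y < x" "x < z"
  then show "\<exists>d. (H_fun p has_real_derivative d) (at x) \<and> d < 0"
    using assms by (intro exI[of _ "p * (p - 1) * x powr (p - 2) * (1 - x)"])
      (auto intro!: H_fun_deriv simp: mult_pos_neg)
next
  show "continuous_on {y..z} (H_fun p)"
    using assms by (intro H_fun_continuous_on)
qed

lemma H_fun_one: "H_fun p 1 = 1"
  by (simp add: H_fun_def)

lemma H_fun_end:
  assumes "p > 1" shows "H_fun p (p / (p - 1)) = 0"
proof -
  define z where "z = p / (p - 1)"
  have z: "z > 0" "(p - 1) * z = p" using assms by (auto simp: z_def)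
  have "z powr p = z * z powr (p - 1)" using z powr_add[of z 1 "p - 1"] by simp
  then have "H_fun p z = (p - (p - 1) * z) * z powr (p - 1)"
    by (simp add: H_fun_def algebra_simps)
  then show ?thesis using z by (simp add: z_def)
qed

text \<open>These facts make \<open>the_inv_into\<close> a genuine inverse here: strict monotonicity
  gives injectivity, and the intermediate value theorem between the end values 1 and 0 gives
  surjectivity onto [0, 1].\<close>

lemma omega_fun:
  assumes "p > 1" "0 \<le> q" "q \<le> 1"
  shows "omega_fun p q \<in> {1..p / (p - 1)}" "H_fun p (omega_fun p q) = q"
proof -
  have inj: "inj_on (H_fun p) {1..p / (p - 1)}"
    by (rule linorder_inj_onI) (use H_fun_strict_antimono[OF assms(1)] in force)+
  have "continuous_on {1..p / (p - 1)} (H_fun p)"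
    by (intro H_fun_continuous_on) simp
  then have "\<exists>z\<ge>1. z \<le> p / (p - 1) \<and> H_fun p z = q"
    using assms by (intro IVT2') (auto simp: H_fun_one H_fun_end field_simps)
  then have img: "q \<in> H_fun p ` {1..p / (p - 1)}" by force
  show "H_fun p (omega_fun p q) = q"
    unfolding omega_fun_def by (rule f_the_inv_into_f[OF inj img])
  show "omega_fun p q \<in> {1..p / (p - 1)}"
    unfolding omega_fun_def by (rule the_inv_into_into[OF inj img order_refl])
qed

text \<open>\<open>z\<close> need not lie in the domain of the inverse: \<open>H_fun p\<close>
  decreases strictly on all of [1, oo), and \<open>omega_fun p q\<close> is at least 1, so a larger
  \<open>z\<close> would have a value below \<open>q\<close>.\<close>

lemma le_omega_fun:
  assumes "p > 1" "0 \<le> q" "q \<le> 1" "q \<le> H_fun p z"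
  shows "z \<le> omega_fun p q"
proof (rule ccontr)
  assume "\<not> z \<le> omega_fun p q"
  then have "H_fun p z < q"
    using H_fun_strict_antimono[of p "omega_fun p q" z] omega_fun[OF assms(1-3)] assms(1) by simp
  then show False using assms(4) by simp
qed

lemma H_fun_gt_if_less_omega_fun:
  assumes "p > 1" "0 \<le> q" "q \<le> 1" "1 \<le> z" "z < omega_fun p q"
  shows "q < H_fun p z"
  using H_fun_strict_antimono[of p z "omega_fun p q"] omega_fun[OF assms(1-3)] assms by simp

text \<open>For the step function with values \<open>c \<gamma> ^ m\<close> on sets of measure \<open>a (1 - a) ^ m\<close>, where
  \<open>\<gamma> = (1 - a / r) / (1 - a)\<close>, the mean is \<open>c r\<close> and \<open>Q_fun p a r\<close> is the \<open>p\<close>-th power of the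
  mean divided by the mean of the \<open>p\<close>-th power.\<close>

definition Q_fun :: "real \<Rightarrow> real \<Rightarrow> real \<Rightarrow> real" where
  "Q_fun p a r = r powr p * (1 - ((1 - a / r) / (1 - a)) powr p * (1 - a)) / a"

text \<open>Up to the factor \<open>- (r powr p)\<close>, \<open>Q_fun p a r\<close> is the
  difference quotient at 0 of \<open>g\<close>, where \<open>g 0 = 1\<close> and the derivative
  there is \<open>p - 1 - p / r\<close>.\<close>

lemma Q_fun_tendsto_H_fun:
  assumes "p > 1" "r \<ge> 1"
  shows "((\<lambda>a. Q_fun p a r) \<longlongrightarrow> H_fun p r) (at_right 0)"
proof -
  define g where "g = (\<lambda>a. ((1 - a / r) / (1 - a)) powr p * (1 - a) :: real)"
  have "(g has_real_derivative (p - 1 - p / r)) (at 0)"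
    unfolding g_def using assms
    by (auto intro!: derivative_eq_intros simp: field_simps)
  then have "((\<lambda>a. (g a - g 0) / (a - 0)) \<longlongrightarrow> p - 1 - p / r) (at 0)"
    unfolding has_field_derivative_iff .
  then have "((\<lambda>a. - (r powr p) * ((g a - 1) / a)) \<longlongrightarrow> - (r powr p) * (p - 1 - p / r)) (at 0)"
    by (intro tendsto_mult_left) (simp add: g_def)
  moreover have "- (r powr p) * (p - 1 - p / r) = H_fun p r"
  proof -
    have "r powr p / r = r powr (p - 1)" using assms by (simp add: powr_diff)
    then have "p * (r powr p / r) = p * r powr (p - 1)" by simp
    then show ?thesis by (simp add: H_fun_def algebra_simps)
  qed
  \<comment> \<open>At \<open>a = 0\<close> both sides are 0, since division by 0 yields 0.\<close>
  moreover have "- (r powr p) * ((g a - 1) / a) = Q_fun p a r" for a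
    by (cases "a = 0") (simp_all add: Q_fun_def g_def field_simps)
  ultimately have "((\<lambda>a. Q_fun p a r) \<longlongrightarrow> H_fun p r) (at 0)" by simp
  then show ?thesis by (rule filterlim_mono) (auto simp: at_le)
qed

text \<open>An exact solution is wanted, so that the extremal function has p-th moment exactly
  \<open>F\<close>. For small \<open>a\<close> the values of \<open>Q_fun p a\<close> at a point
  below \<open>omega_fun p q\<close> and at a point above it lie on either side of \<open>q\<close>;
  the intermediate value theorem in \<open>r\<close> does the rest.\<close>

lemma Q_fun_solve:
  assumes "p > 1" "0 < q" "q \<le> 1" "x < omega_fun p q"
  shows "\<exists>a r. 0 < a \<and> a < 1 \<and> 1 \<le> r \<and> x \<le> r \<and> Q_fun p a r = q"
proof (cases "q = 1")
  case True
  have "omega_fun p q = 1"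
    using H_fun_strict_antimono[of p 1 "omega_fun p q"] omega_fun[of p q] assms True
    by (force simp: H_fun_one)
  \<comment> \<open>There is no room between 1 and \<open>omega_fun p q = 1\<close>, but
    \<open>r = 1\<close> solves the equation for every \<open>a\<close> in (0, 1).\<close>
  then show ?thesis
    using assms True by (intro exI[of _ "1/2"] exI[of _ 1]) (auto simp: Q_fun_def)
next
  case False
  define w where "w = omega_fun p q"
  have w: "w \<in> {1..p / (p - 1)}" "H_fun p w = q" unfolding w_def using omega_fun assms by auto
  have "w \<noteq> 1" using False w by (auto simp: H_fun_one)
  \<comment> \<open>The maximum with 1 keeps \<open>r1\<close> in the range where
    \<open>H_fun p\<close> is strictly decreasing.\<close>
  define r1 where "r1 = max 1 x"
  have r1: "1 \<le> r1" "r1 < w" "x \<le> r1" using \<open>w \<noteq> 1\<close> w assms by (auto simp: r1_def w_def)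
  have "q < H_fun p r1" "H_fun p (w + 1) < q"
    using H_fun_strict_antimono[of p r1 w] H_fun_strict_antimono[of p w "w + 1"] w r1 assms by auto
  then have "\<forall>\<^sub>F a in at_right 0. q < Q_fun p a r1" "\<forall>\<^sub>F a in at_right 0. Q_fun p a (w + 1) < q"
    using Q_fun_tendsto_H_fun[of p r1] Q_fun_tendsto_H_fun[of p "w + 1"] r1 w assms
    by (auto intro: order_tendstoD)
  moreover have "\<forall>\<^sub>F a::real in at_right 0. 0 < a \<and> a < 1"
    by (auto simp: eventually_at_right_field intro!: exI[of _ 1])
  ultimately have "\<forall>\<^sub>F a in at_right 0. q < Q_fun p a r1 \<and> Q_fun p a (w + 1) < q \<and> 0 < a \<and> a < 1"
    by eventually_elim auto
  then obtain a where a: "q < Q_fun p a r1" "Q_fun p a (w + 1) < q" "0 < a" "a < 1"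
    using eventually_happens'[of "at_right (0::real)"] by (auto simp: trivial_limit_at_right_real)
  have "continuous_on {r1..w+1} (Q_fun p a)"
    unfolding Q_fun_def[abs_def] using a r1
    by (auto intro!: continuous_intros simp: field_simps)
  then have "\<exists>r\<ge>r1. r \<le> w + 1 \<and> Q_fun p a r = q"
    using a r1 by (intro IVT2') auto
  then obtain r where "r1 \<le> r" "Q_fun p a r = q" by blast
  then show ?thesis using a r1 by (intro exI[of _ a] exI[of _ r]) auto
qed

section \<open>Trees\<close>

text \<open>Comparison with the geometric series. Base 3 is what makes the digits after position
  \<open>N\<close> amount to at most half of a unit digit at position \<open>N\<close>.\<close>

lemma ternary_tail:
  fixes c :: "nat \<Rightarrow> real"
  assumes "\<And>n. \<bar>c n\<bar> \<le> 1"
  shows "summable (\<lambda>n. c n / 3 ^ n)"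
    and "\<bar>\<Sum>n. c (n + N) / 3 ^ (n + N)\<bar> \<le> 3 / 2 * (1 / 3) ^ N"
proof -
  have sumg: "summable (\<lambda>n. (1 / 3 :: real) ^ n)" by (simp add: summable_geometric)
  have le: "norm (c n / 3 ^ n) \<le> (1 / 3) ^ n" for n
    using assms[of n] by (simp add: power_divide divide_right_mono)
  show "summable (\<lambda>n. c n / 3 ^ n)"
    by (rule summable_comparison_test'[OF sumg le])
  have le': "norm (c (n + N) / 3 ^ (n + N)) \<le> (1 / 3) ^ (n + N)" for n
    by (rule le)
  have sumg': "summable (\<lambda>n. (1 / 3 :: real) ^ (n + N))"
    by (rule summable_ignore_initial_segment[OF sumg])
  have sumn: "summable (\<lambda>n. norm (c (n + N) / 3 ^ (n + N)))"
    by (rule summable_comparison_test'[OF sumg']) (use le' in simp)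
  have "norm (\<Sum>n. c (n + N) / 3 ^ (n + N)) \<le> (\<Sum>n. norm (c (n + N) / 3 ^ (n + N)))"
    by (rule summable_norm[OF sumn])
  also have "\<dots> \<le> (\<Sum>n. (1 / 3) ^ (n + N))"
    by (rule suminf_le[OF le' sumn sumg'])
  also have "\<dots> = (\<Sum>n. (1 / 3) ^ n * (1 / 3) ^ N)" by (simp add: power_add)
  also have "\<dots> = (\<Sum>n. (1 / 3) ^ n) * (1 / 3) ^ N"
    by (rule suminf_mult2[symmetric, OF sumg])
  also have "\<dots> = 3 / 2 * (1 / 3) ^ N" by (simp add: suminf_geometric)
  finally show "\<bar>\<Sum>n. c (n + N) / 3 ^ (n + N)\<bar> \<le> 3 / 2 * (1 / 3) ^ N" by simp
qed

text \<open>Fixes one witness \<open>C\<close> of the existential in \<open>is_tree\<close>, so that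
  levels of the tree can be named.\<close>

locale maximal_tree = prob_space M for M :: "'a measure" +
  fixes T :: "'a set set" and C :: "'a set \<Rightarrow> 'a set set"
  assumes T_sets: "T \<subseteq> sets M"
    and T_pos: "\<And>I. I \<in> T \<Longrightarrow> measure M I > 0"
    and C_subset: "\<And>I. I \<in> T \<Longrightarrow> C I \<subseteq> T"
    and C_countable: "\<And>I. I \<in> T \<Longrightarrow> countable (C I)"
    and C_disjoint: "\<And>I. I \<in> T \<Longrightarrow> disjoint (C I)"
    and C_Union: "\<And>I. I \<in> T \<Longrightarrow> \<Union>(C I) = I"
    and T_eq: "T = (\<Union>m. tree_level (space M) C m)"
    and level_tendsto: "(\<lambda>m. SUP I\<in>tree_level (space M) C m. measure M I) \<longlonglongrightarrow> 0"
    and T_diff: "differentiates_L1 M T"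
begin

section \<open>Levels of the tree, nestedness and disjoint subfamilies\<close>

abbreviation lev :: "nat \<Rightarrow> 'a set set" where
  "lev m \<equiv> tree_level (space M) C m"

lemma lev_subset: "lev m \<subseteq> T"
  using T_eq by blast

lemma ex_lev: "I \<in> T \<Longrightarrow> \<exists>m. I \<in> lev m"
  using T_eq by blast

lemma space_in_T: "space M \<in> T"
  using lev_subset[of 0] by simp

lemma countable_lev: "countable (lev m)"
proof (induction m)
  case (Suc m)
  then show ?case using C_countable lev_subset by auto
qed simp

lemma countable_T: "countable T"
  by (subst T_eq) (simp add: countable_lev)

lemma T_measurable [measurable]: "I \<in> T \<Longrightarrow> I \<in> sets M"
  using T_sets by blast

lemma Union_measurable: "\<G> \<subseteq> T \<Longrightarrow> \<Union>\<G> \<in> sets M"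
  using countable_subset[OF _ countable_T] T_sets by (intro sets.countable_Union) auto

lemma C_subset_parent: "I \<in> T \<Longrightarrow> J \<in> C I \<Longrightarrow> J \<subseteq> I"
  using C_Union by blast

lemma disjoint_lev: "disjoint (lev m)"
proof (induction m)
  case (Suc m)
  show ?case
  proof (rule disjointI)
    fix J J' assume J: "J \<in> lev (Suc m)" "J' \<in> lev (Suc m)" "J \<noteq> J'"
    then obtain I I' where I: "I \<in> lev m" "J \<in> C I" "I' \<in> lev m" "J' \<in> C I'" by auto
    then have T: "I \<in> T" "I' \<in> T" using lev_subset by auto
    show "J \<inter> J' = {}"
    proof (cases "I = I'")
      case True
      then show ?thesis using C_disjoint[OF T(1)] I J(3) by (auto dest: disjointD)
    next
      case False
      then have "I \<inter> I' = {}" using Suc I by (auto dest: disjointD)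
      then show ?thesis using C_subset_parent T I by blast
    qed
  qed
qed simp

lemma Union_lev: "\<Union>(lev m) = space M"
proof (induction m)
  case (Suc m)
  have "\<Union>(lev (Suc m)) = (\<Union>I\<in>lev m. \<Union>(C I))" by auto
  also have "\<dots> = (\<Union>I\<in>lev m. I)"
    by (rule SUP_cong[OF refl C_Union]) (use lev_subset in blast)
  finally show ?case using Suc by simp
qed simp

lemma lev_nested_add:
  assumes "I \<in> lev m" "J \<in> lev (m + n)"
  shows "J \<subseteq> I \<or> J \<inter> I = {}"
  using assms(2)
proof (induction n arbitrary: J)
  case 0
  then show ?case using assms(1) disjoint_lev[of m] by (auto dest: disjointD)
next
  case (Suc n)
  then obtain J' where J': "J' \<in> lev (m + n)" "J \<in> C J'" by auto
  then have "J \<subseteq> J'" using C_subset_parent lev_subset by blast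
  then show ?case using Suc.IH[OF J'(1)] by blast
qed

lemma lev_nested:
  assumes "I \<in> lev m" "J \<in> lev n" "m \<le> n"
  shows "J \<subseteq> I \<or> J \<inter> I = {}"
  using lev_nested_add[of I m J "n - m"] assms by simp

lemma ex_lev_small:
  assumes "e > 0"
  shows "\<exists>m. \<forall>I\<in>lev m. measure M I < e"
proof -
  obtain m where m: "(SUP I\<in>lev m. measure M I) < e"
    using order_tendstoD(2)[OF level_tendsto assms] by (auto simp: eventually_sequentially)
  have "bdd_above (measure M ` lev m)" by (intro bdd_aboveI[of _ 1]) auto
  then have "measure M I < e" if "I \<in> lev m" for I
    using cSUP_upper[OF that] m by fastforce
  then show ?thesis by blast
qed

text \<open>Tree sets are nested or disjoint, so the inclusion-maximal members of the family are
  pairwise disjoint. Among the members containing a given point, one of lowest level is maximal, so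
  nothing is lost from the union.\<close>

lemma ex_disjoint_subfamily:
  assumes "\<G> \<subseteq> T"
  shows "\<exists>\<S>\<subseteq>\<G>. disjoint \<S> \<and> \<Union>\<S> = \<Union>\<G>"
proof -
  define \<S> where "\<S> = {I \<in> \<G>. \<forall>J\<in>\<G>. I \<subseteq> J \<longrightarrow> I = J}"
  have cmp: "I \<subseteq> J \<or> J \<subseteq> I \<or> I \<inter> J = {}" if IJ: "I \<in> T" "J \<in> T" for I J
  proof -
    obtain m n where "I \<in> lev m" "J \<in> lev n" using ex_lev IJ by meson
    then show ?thesis using lev_nested[of I m J n] lev_nested[of J n I m]
      by (cases "m \<le> n") auto
  qed
  have "disjoint \<S>"
  proof (rule disjointI)
    fix I J assume "I \<in> \<S>" "J \<in> \<S>" "I \<noteq> J"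
    moreover from this have "I \<in> T" "J \<in> T" using assms by (auto simp: \<S>_def)
    ultimately show "I \<inter> J = {}" using cmp[of I J] by (auto simp: \<S>_def)
  qed
  moreover have "\<Union>\<G> \<subseteq> \<Union>\<S>"
  proof
    fix x assume "x \<in> \<Union>\<G>"
    then obtain I where I: "I \<in> \<G>" "x \<in> I" by blast
    then obtain m where "I \<in> lev m" using ex_lev assms by blast
    with I have ex: "\<exists>m I. I \<in> \<G> \<and> x \<in> I \<and> I \<in> lev m" by blast
    define m0 where "m0 = (LEAST m. \<exists>I. I \<in> \<G> \<and> x \<in> I \<and> I \<in> lev m)"
    obtain I0 where I0: "I0 \<in> \<G>" "x \<in> I0" "I0 \<in> lev m0"
      using LeastI_ex[OF ex] unfolding m0_def by blast
    have "I0 = J" if J: "J \<in> \<G>" "I0 \<subseteq> J" for J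
    proof -
      obtain n where n: "J \<in> lev n" using J assms ex_lev by blast
      then have "m0 \<le> n" unfolding m0_def using J I0 by (intro Least_le) blast
      then show ?thesis using lev_nested[OF I0(3) n] I0 J by blast
    qed
    then show "x \<in> \<Union>\<S>" using I0 unfolding \<S>_def by blast
  qed
  ultimately show ?thesis by (intro exI[of _ \<S>]) (auto simp: \<S>_def)
qed

text \<open>Ternary digits of the address of \<open>x\<close> record which tree sets contain \<open>x\<close>; so the address has null
  fibres, and it is continuous for the topology generated by the tree.\<close>

definition address :: "'a \<Rightarrow> real" where
  "address x = (\<Sum>n. indicator (from_nat_into T n) x / 3 ^ n)"

lemma address_measurable [measurable]: "address \<in> borel_measurable M"
proof -
  have [measurable]: "from_nat_into T n \<in> sets M" for n
    using from_nat_into[of T n] space_in_T T_sets by auto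
  show ?thesis unfolding address_def[abs_def] by measurable
qed

text \<open>Equal digits before \<open>N\<close> cancel, and the digits after \<open>N\<close>
  contribute at most half of \<open>1 / 3 ^ N\<close>; hence digit \<open>N\<close> decides the
  comparison.\<close>

lemma address_diff:
  assumes "\<And>n. n < N \<Longrightarrow> x \<in> from_nat_into T n \<longleftrightarrow> y \<in> from_nat_into T n"
  shows "\<bar>address x - address y - (indicator (from_nat_into T N) x - indicator (from_nat_into T N) y) / 3 ^ N\<bar>
      \<le> 1 / 2 * (1 / 3) ^ N"
proof -
  define c where "c n = (indicator (from_nat_into T n) x - indicator (from_nat_into T n) y :: real)" for n
  have c: "\<bar>c n\<bar> \<le> 1" for n by (auto simp: c_def indicator_def)
  have "address x - address y = (\<Sum>n. c n / 3 ^ n)"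
    unfolding address_def c_def diff_divide_distrib
    by (rule suminf_diff; rule ternary_tail) (auto simp: indicator_def)
  also have "\<dots> = (\<Sum>n. c (n + Suc N) / 3 ^ (n + Suc N)) + (\<Sum>n<Suc N. c n / 3 ^ n)"
    by (rule suminf_split_initial_segment[OF ternary_tail(1)[OF c]])
  also have "(\<Sum>n<Suc N. c n / 3 ^ n) = c N / 3 ^ N"
  proof -
    have "(\<Sum>n<N. c n / 3 ^ n) = 0"
      by (rule sum.neutral) (use assms in \<open>auto simp: c_def indicator_def\<close>)
    then show ?thesis by simp
  qed
  finally have "address x - address y - c N / 3 ^ N = (\<Sum>n. c (n + Suc N) / 3 ^ (n + Suc N))"
    by simp
  then show ?thesis
    using ternary_tail(2)[of c "Suc N", OF c] by (simp add: c_def)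
qed

text \<open>At the first set in the enumeration that separates \<open>x\<close> from
  \<open>y\<close>, the digit difference has size \<open>1 / 3 ^ N\<close>, which the remaining
  digits cannot compensate.\<close>

lemma address_inj:
  assumes "address x = address y" "I \<in> T"
  shows "x \<in> I \<longleftrightarrow> y \<in> I"
proof (rule ccontr)
  assume neq: "\<not> (x \<in> I \<longleftrightarrow> y \<in> I)"
  let ?P = "\<lambda>n. x \<in> from_nat_into T n \<longleftrightarrow> y \<in> from_nat_into T n"
  have "\<not> ?P (to_nat_on T I)" using neq assms(2) countable_T by simp
  then have N: "\<not> ?P (LEAST n. \<not> ?P n)" by (rule LeastI)
  define N where "N = (LEAST n. \<not> ?P n)"
  have "?P n" if "n < N" for n using not_less_Least that unfolding N_def by blast
  from address_diff[OF this] have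
    "\<bar>(indicator (from_nat_into T N) x - indicator (from_nat_into T N) y) / 3 ^ N :: real\<bar> \<le> 1 / 2 * (1 / 3) ^ N"
    using assms(1) by simp
  moreover have "\<bar>(indicator (from_nat_into T N) x - indicator (from_nat_into T N) y) / 3 ^ N :: real\<bar> = (1 / 3) ^ N"
    using N unfolding N_def[symmetric] by (auto simp: indicator_def power_divide)
  ultimately have "(1 / 3 :: real) ^ N \<le> 1 / 2 * (1 / 3) ^ N" by linarith
  moreover have "(1 / 3 :: real) ^ N > 0" by simp
  ultimately show False by linarith
qed

text \<open>By \<open>address_inj\<close> a nonempty fibre lies inside a single set of each level,
  and the measures of these sets tend to 0.\<close>

lemma address_fibre_null: "measure M {x \<in> space M. address x = c} = 0"
proof (rule ccontr)
  assume "measure M {x \<in> space M. address x = c} \<noteq> 0"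
  then have pos: "0 < measure M {x \<in> space M. address x = c}" by (simp add: order_less_le)
  then obtain m where m: "\<forall>I\<in>lev m. measure M I < measure M {x \<in> space M. address x = c}"
    using ex_lev_small by blast
  have "{x \<in> space M. address x = c} \<noteq> {}" using pos by (auto simp del: Collect_empty_eq)
  then obtain x where x: "x \<in> space M" "address x = c" by blast
  then obtain I where I: "I \<in> lev m" "x \<in> I" using Union_lev by blast
  then have "I \<in> T" using lev_subset by blast
  then have "{x \<in> space M. address x = c} \<subseteq> I"
    using address_inj[of x _ I] I x by auto
  then have "measure M {x \<in> space M. address x = c} \<le> measure M I"
    using I lev_subset T_sets by (intro finite_measure_mono) auto
  then show False using m I by force
qed

text \<open>Sublevel sets of the address are open for the tree: on a sufficiently deep tree set the
  first \<open>N\<close> digits are constant, and the other digits move the address by less than the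
  gap \<open>s - address x\<close>.\<close>

lemma address_less_open:
  assumes "x \<in> space M" "address x < s"
  shows "\<exists>m0. \<forall>m\<ge>m0. \<forall>J\<in>lev m. x \<in> J \<longrightarrow> (\<forall>y\<in>J. address y < s)"
proof -
  have "(\<lambda>N. 3 / 2 * (1 / 3 :: real) ^ N) \<longlonglongrightarrow> 3 / 2 * 0"
    by (intro tendsto_intros LIMSEQ_power_zero) auto
  then have "\<forall>\<^sub>F N in sequentially. 3 / 2 * (1 / 3 :: real) ^ N < s - address x"
    by (rule order_tendstoD(2)) (use assms in simp)
  \<comment> \<open>The constant 3/2 is 1 for digit \<open>N\<close> itself plus 1/2 for all later
    digits.\<close>
  then obtain N where N: "3 / 2 * (1 / 3 :: real) ^ N < s - address x"
    by (auto simp: eventually_sequentially)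
  have "\<forall>n. \<exists>m. from_nat_into T n \<in> lev m"
    using from_nat_into[of T] space_in_T ex_lev by (metis empty_iff)
  then obtain l where l: "\<And>n. from_nat_into T n \<in> lev (l n)" by metis
  show ?thesis
  proof (intro exI allI impI ballI)
    \<comment> \<open>The sum of the levels of the first \<open>N\<close> sets bounds each of them,
      so \<open>J\<close> lies inside or off every one of these sets.\<close>
    fix m J y assume mJ: "(\<Sum>n<N. l n) \<le> m" "J \<in> lev m" "x \<in> J" "y \<in> J"
    have "x \<in> from_nat_into T n \<longleftrightarrow> y \<in> from_nat_into T n" if "n < N" for n
    proof -
      have "l n \<le> m" using member_le_sum[of n "{..<N}" l] that mJ(1) by auto
      then show ?thesis using lev_nested[OF l mJ(2)] mJ by blast
    qed
    from address_diff[OF this] have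
      "\<bar>address x - address y - (indicator (from_nat_into T N) x - indicator (from_nat_into T N) y) / 3 ^ N\<bar>
        \<le> 1 / 2 * (1 / 3) ^ N" by simp
    moreover have "\<bar>(indicator (from_nat_into T N) x - indicator (from_nat_into T N) y) / 3 ^ N :: real\<bar> \<le> (1 / 3) ^ N"
      by (auto simp: indicator_def power_divide)
    ultimately show "address y < s" using N by linarith
  qed
qed

text \<open>The distribution function of the address on \<open>D\<close> is continuous because
  fibres are null, so it takes every intermediate value.\<close>

lemma ex_address_level:
  assumes [measurable]: "D \<in> sets M" and t: "0 \<le> t" "t \<le> measure M D"
  shows "\<exists>s. measure M (D \<inter> {x \<in> space M. address x < s}) = t"
proof -
  define N where "N = distr (density M (indicator D)) borel address"
  have N_eq: "emeasure N A = emeasure M (D \<inter> (address -` A \<inter> space M))" if "A \<in> sets borel" for A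
    using that measurable_sets[OF address_measurable that]
    by (simp add: N_def emeasure_distr emeasure_restricted)
  then have N_meas: "measure N A = measure M (D \<inter> (address -` A \<inter> space M))" if "A \<in> sets borel" for A
    using that by (simp add: measure_def)
  interpret N: finite_borel_measure N
  proof (intro finite_borel_measure.intro finite_borel_measure_axioms.intro finite_measureI)
    have "emeasure N UNIV \<noteq> \<infinity>" unfolding N_eq[OF sets.top[of borel, unfolded space_borel]] by simp
    then show "emeasure N (space N) \<noteq> \<infinity>" by (simp add: N_def)
  qed (simp add: N_def)
  have null: "measure N {c} = 0" for c
  proof -
    have "measure N {c} = measure M (D \<inter> (address -` {c} \<inter> space M))"
      by (rule N_meas) simp
    also have "\<dots> \<le> measure M {x \<in> space M. address x = c}"
      by (intro finite_measure_mono) auto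
    finally show ?thesis by (simp add: address_fibre_null measure_le_0_iff)
  qed
  have bnd: "0 \<le> address x" "address x \<le> 3 / 2" for x
  proof -
    have "\<bar>indicator (from_nat_into T n) x :: real\<bar> \<le> 1" for n by (auto simp: indicator_def)
    note d = ternary_tail[of "\<lambda>n. indicator (from_nat_into T n) x", OF this]
    show "0 \<le> address x"
      unfolding address_def by (rule suminf_nonneg[OF d(1)]) simp
    show "address x \<le> 3 / 2"
      unfolding address_def using d(2)[of 0] by simp
  qed
  \<comment> \<open>The points -1 and 2 lie outside the range [0, 3/2] of the address, on either
    side.\<close>
  have "cdf N (-1) = 0"
  proof -
    have "\<not> address x \<le> - 1" for x using bnd(1)[of x] by simp
    then have "D \<inter> (address -` {..-1} \<inter> space M) = {}" by auto
    then show ?thesis by (simp add: cdf_def N_meas)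
  qed
  moreover have "cdf N 2 = measure M D"
  proof -
    have "address x \<le> 2" for x using bnd(2)[of x] by simp
    then have "D \<inter> (address -` {..2} \<inter> space M) = D" using sets.sets_into_space[OF assms(1)] by auto
    then show ?thesis by (simp add: cdf_def N_meas)
  qed
  moreover have "\<forall>x. - 1 \<le> x \<and> x \<le> 2 \<longrightarrow> isCont (cdf N) x" using N.isCont_cdf null by simp
  ultimately obtain s where s: "cdf N s = t"
    using IVT[of "cdf N" "-1" t 2] t by auto
  \<comment> \<open>\<open>cdf\<close> uses closed half-lines. Dropping the null fibre gives the
    strict sublevel set, the one that is open for the tree.\<close>
  have "cdf N s = measure N {..<s} + measure N {s}"
    unfolding cdf_def ivl_disj_un(2)[symmetric]
    by (rule N.finite_measure_Union) (auto simp: N_def)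
  then have "t = measure M (D \<inter> (address -` {..<s} \<inter> space M))" using null s N_meas by simp
  moreover have "address -` {..<s} \<inter> space M = {x \<in> space M. address x < s}" by auto
  ultimately show ?thesis by auto
qed

section \<open>Sets and disjoint tree families of prescribed measure\<close>

lemma ex_subset_measure:
  assumes "D \<in> sets M" "E \<in> sets M" "E \<subseteq> D" "measure M E \<le> t" "t \<le> measure M D"
  shows "\<exists>K\<in>sets M. E \<subseteq> K \<and> K \<subseteq> D \<and> measure M K = t"
proof -
  have "measure M (D - E) = measure M D - measure M E"
    using assms by (intro finite_measure_Diff) auto
  then obtain s where s: "measure M ((D - E) \<inter> {x \<in> space M. address x < s}) = t - measure M E"
    using ex_address_level[of "D - E" "t - measure M E"] assms by auto
  have [measurable]: "D \<in> sets M" "E \<in> sets M" by fact+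
  let ?K = "E \<union> (D - E) \<inter> {x \<in> space M. address x < s}"
  have "measure M ?K = measure M E + measure M ((D - E) \<inter> {x \<in> space M. address x < s})"
    by (rule finite_measure_Union) auto
  then show ?thesis using s assms by (intro bexI[of _ ?K]) auto
qed

text \<open>A sublevel set of the address inside \<open>I\<close> has the right measure and, by
  \<open>address_less_open\<close>, is the union of the tree sets it contains.\<close>

lemma ex_subfamily_measure:
  assumes "I \<in> T" "0 \<le> t" "t \<le> measure M I"
  shows "\<exists>\<S>\<subseteq>T. disjoint \<S> \<and> (\<forall>J\<in>\<S>. J \<subseteq> I) \<and> measure M (\<Union>\<S>) = t"
proof -
  have I[measurable]: "I \<in> sets M" using assms T_sets by blast
  obtain s where s: "measure M (I \<inter> {x \<in> space M. address x < s}) = t"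
    using ex_address_level[OF I assms(2,3)] by blast
  define \<G> where "\<G> = {J \<in> T. J \<subseteq> I \<and> (\<forall>y\<in>J. address y < s)}"
  have "\<Union>\<G> = I \<inter> {x \<in> space M. address x < s}"
  proof
    show "\<Union>\<G> \<subseteq> I \<inter> {x \<in> space M. address x < s}"
      using sets.sets_into_space[OF I] by (auto simp: \<G>_def)
    show "I \<inter> {x \<in> space M. address x < s} \<subseteq> \<Union>\<G>"
    proof
      fix x assume x: "x \<in> I \<inter> {x \<in> space M. address x < s}"
      obtain n where n: "I \<in> lev n" using assms(1) ex_lev by blast
      obtain m0 where m0: "\<forall>m\<ge>m0. \<forall>J\<in>lev m. x \<in> J \<longrightarrow> (\<forall>y\<in>J. address y < s)"
        using address_less_open[of x s] x by blast
      \<comment> \<open>The level is deep enough both for the bound on the address and for nesting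
        inside \<open>I\<close>.\<close>
      obtain J where J: "J \<in> lev (max m0 n)" "x \<in> J" using Union_lev x by blast
      have "J \<subseteq> I" using lev_nested[OF n J(1)] J x by auto
      moreover have "\<forall>y\<in>J. address y < s" using m0[rule_format, of "max m0 n" J] J by simp
      moreover have "J \<in> T" using J lev_subset by blast
      ultimately show "x \<in> \<Union>\<G>" using J(2) unfolding \<G>_def by blast
    qed
  qed
  moreover obtain \<S> where "\<S> \<subseteq> \<G>" "disjoint \<S>" "\<Union>\<S> = \<Union>\<G>"
    using ex_disjoint_subfamily[of \<G>] by (auto simp: \<G>_def)
  ultimately show ?thesis using s by (intro exI[of _ \<S>]) (auto simp: \<G>_def)
qed

end

lemma is_tree_imp_maximal_tree:
  assumes "prob_space M" "is_tree M T"
  shows "\<exists>C. maximal_tree M T C"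
proof -
  from assms(2) obtain C where C:
    "\<forall>I\<in>T. C I \<subseteq> T \<and> countable (C I) \<and> (\<exists>J\<in>C I. \<exists>J'\<in>C I. J \<noteq> J') \<and>
       disjoint (C I) \<and> (\<forall>J\<in>C I. J \<subseteq> I) \<and> I = \<Union>(C I)"
    "T = (\<Union>m. tree_level (space M) C m)"
    "(\<lambda>m. SUP I\<in>tree_level (space M) C m. measure M I) \<longlonglongrightarrow> 0"
    and T: "T \<subseteq> sets M" "\<forall>I\<in>T. measure M I > 0" "differentiates_L1 M T"
    unfolding is_tree_def by (elim conjE exE) (rule that)
  have "maximal_tree M T C"
  proof (intro maximal_tree.intro maximal_tree_axioms.intro)
    fix I assume I: "I \<in> T"
    show "measure M I > 0" "C I \<subseteq> T" "countable (C I)" "disjoint (C I)" "\<Union>(C I) = I"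
      using bspec[OF T(2) I] bspec[OF C(1) I] by (elim conjE, simp only:)+
  qed (fact assms(1) C T)+
  then show ?thesis by (intro exI)
qed

section \<open>Integral inequalities\<close>

lemma ennreal_nn_integral_indicator:
  fixes g :: "'a \<Rightarrow> real"
  assumes "\<And>x. x \<in> space M \<Longrightarrow> 0 \<le> g x" "set_integrable M S g"
  shows "(\<integral>\<^sup>+x\<in>S. ennreal (g x) \<partial>M) = ennreal (LINT x:S|M. g x)"
proof -
  have "(\<integral>\<^sup>+x\<in>S. ennreal (g x) \<partial>M) = (\<integral>\<^sup>+x. ennreal (indicator S x *\<^sub>R g x) \<partial>M)"
    by (intro nn_integral_cong) (auto simp: indicator_def)
  also have "\<dots> = ennreal (\<integral>x. indicator S x *\<^sub>R g x \<partial>M)"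
    using assms unfolding set_integrable_def by (intro nn_integral_eq_integral) (auto simp: indicator_def)
  finally show ?thesis by (simp add: set_lebesgue_integral_def)
qed

lemma (in finite_measure) set_integrable_bounded:
  fixes g :: "'a \<Rightarrow> real"
  assumes "g \<in> borel_measurable M" "S \<in> sets M" "\<And>x. x \<in> space M \<Longrightarrow> \<bar>g x\<bar> \<le> c"
  shows "set_integrable M S g"
  using assms unfolding set_integrable_def
  by (intro integrable_mult_indicator integrable_const_bound[of _ c]) auto

lemma integrable_set_integrable:
  fixes g :: "'a \<Rightarrow> real"
  assumes "integrable M g" "S \<in> sets M"
  shows "set_integrable M S g"
  using assms unfolding set_integrable_def by (intro integrable_mult_indicator)

text \<open>Jensen's inequality for the \<open>p\<close>-th power on \<open>S\<close>, obtained by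
  integrating \<open>powr_young\<close> with \<open>y\<close> equal to the mean \<open>d\<close> of
  \<open>\<phi>\<close> over \<open>S\<close>.\<close>

lemma (in finite_measure) set_integral_powr_ge:
  fixes \<phi> :: "'a \<Rightarrow> real"
  assumes "p > 1" "\<And>x. x \<in> space M \<Longrightarrow> 0 \<le> \<phi> x"
    and S[measurable]: "S \<in> sets M" "measure M S > 0"
    and int: "integrable M \<phi>" "integrable M (\<lambda>x. \<phi> x powr p)"
  shows "(LINT x:S|M. \<phi> x) powr p / measure M S powr (p - 1) \<le> (LINT x:S|M. \<phi> x powr p)"
proof -
  define m s d where "m = measure M S" and "s = (LINT x:S|M. \<phi> x)" and "d = s / m"
  have m: "m > 0" using assms by (simp add: m_def)
  have s: "0 \<le> s" unfolding s_def set_lebesgue_integral_def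
    using assms(2) by (intro integral_nonneg_AE) (auto simp: indicator_def)
  have d: "d \<ge> 0" using m s by (simp add: d_def)
  have cst: "set_integrable M S (\<lambda>x. c)" for c :: real
    by (rule set_integrable_bounded[of _ _ "\<bar>c\<bar>"]) auto
  have I1: "set_integrable M S \<phi>" "set_integrable M S (\<lambda>x. \<phi> x powr p)"
    using int by (auto intro: integrable_set_integrable)
  have "(LINT x:S|M. p * d powr (p - 1) * \<phi> x) \<le> (LINT x:S|M. \<phi> x powr p + (p - 1) * d powr p)"
  proof (rule set_integral_mono)
    fix x assume "x \<in> S"
    then have "0 \<le> \<phi> x" using assms(2) sets.sets_into_space[OF S(1)] by auto
    from powr_young[OF assms(1) this d]
    show "p * d powr (p - 1) * \<phi> x \<le> \<phi> x powr p + (p - 1) * d powr p" by (simp add: mult_ac)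
  qed (use I1 cst in \<open>auto intro!: set_integrable_mult_right set_integral_add\<close>)
  also have "\<dots> = (LINT x:S|M. \<phi> x powr p) + (LINT x:S|M. (p - 1) * d powr p)"
    using I1 cst by (intro set_integral_add) auto
  also have "(LINT x:S|M. (p - 1) * d powr p) = m * ((p - 1) * d powr p)"
    by (simp add: set_lebesgue_integral_def m_def)
  finally have *: "p * d powr (p - 1) * s \<le> (LINT x:S|M. \<phi> x powr p) + m * ((p - 1) * d powr p)"
    by (simp add: s_def)
  have "d powr (p - 1) * s = m * d powr p"
  proof (cases "d = 0")
    case True
    then show ?thesis by simp
  next
    case False
    then have "d powr p = d * d powr (p - 1)" using d powr_add[of d 1 "p - 1"] by simp
    then show ?thesis using m by (simp add: d_def)
  qed
  then have "p * d powr (p - 1) * s = p * (m * d powr p)" by simp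
  with * have "p * (m * d powr p) \<le> (LINT x:S|M. \<phi> x powr p) + m * ((p - 1) * d powr p)" by simp
  then have "m * d powr p \<le> (LINT x:S|M. \<phi> x powr p)" by (simp add: algebra_simps)
  moreover have "m * d powr p = s powr p / m powr (p - 1)"
    using m s powr_diff[of m 1 p] powr_diff[of m p 1] by (simp add: d_def powr_divide)
  ultimately show ?thesis by (simp add: m_def s_def)
qed

text \<open>The algebraic core of the upper bound. Here \<open>a\<close> and \<open>a'\<close> stand
  for the integrals of \<open>\<phi> powr p\<close> over the superlevel set and its complement,
  \<open>J\<close> for that of \<open>g powr p\<close> and \<open>Y\<close> for that of
  \<open>\<phi> * g powr (p - 1)\<close> over the superlevel set. The family \<open>young\<close> is
  Hoelder's inequality before optimising in \<open>z\<close>.\<close>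

lemma candidate_ge:
  fixes p f F k b J Y a a' :: real
  assumes "p > 1" "0 < k" "k < 1" "0 < b" "a + a' = F"
    and a: "(b * k) powr p / k powr (p - 1) \<le> a"
    and a': "(f - b * k) powr p / (1 - k) powr (p - 1) \<le> a'"
    and Y: "(p - 1) * J + k * b powr p \<le> p * Y"
    and young: "\<And>z. z > 0 \<Longrightarrow> p * z * Y \<le> z powr p * a + (p - 1) * J"
    and J: "k * b powr p \<le> J"
  shows "h_fun p f k (b * k) \<le> F" "J \<le> candidate p f F k (b * k)"
proof -
  have kb: "(b * k) powr p / k powr (p - 1) = k * b powr p"
    using assms powr_diff[of k p 1] by (simp add: powr_mult)
  show "h_fun p f k (b * k) \<le> F" using assms by (simp add: h_fun_def)
  define A where "A = F - (f - b * k) powr p / (1 - k) powr (p - 1)"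
  have A: "a \<le> A" using a' assms(5) by (simp add: A_def)
  \<comment> \<open>Positivity of \<open>b\<close> forces \<open>A > 0\<close>, which excludes the
    degenerate branch of \<open>candidate\<close>.\<close>
  have pos: "0 < k * b powr p" using assms by simp
  then have A0: "0 < A" and J0: "0 < J" using A a kb J by linarith+
  define q where "q = (b * k) powr p / (k powr (p - 1) * A)"
  have q_eq: "q = k * b powr p / A" unfolding kb[symmetric] q_def by simp
  have q: "0 \<le> q" "q \<le> 1" using A a kb A0 pos by (auto simp: q_eq)
  \<comment> \<open>This \<open>z\<close> satisfies \<open>z powr p * A = J\<close>, so the
    right-hand side of \<open>young\<close> collapses to \<open>p * J\<close>.\<close>
  define z where "z = (J / A) powr (1 / p)"
  have z: "0 < z" "z powr p = J / A" using A0 J0 assms by (auto simp: z_def powr_powr)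
  have "p * z * Y \<le> z powr p * A + (p - 1) * J"
    using young[OF z(1)] A mult_left_mono[of a A "z powr p"] by simp
  also have "\<dots> = p * J" using A0 z by (simp add: algebra_simps)
  finally have "z * (p * Y) \<le> p * J" by (simp add: mult_ac)
  then have "z * ((p - 1) * J + k * b powr p) \<le> p * J"
    using mult_left_mono[OF Y, of z] z by linarith
  then have "(p - 1) * J + k * b powr p \<le> p * J / z"
    using z by (simp add: pos_le_divide_eq mult.commute)
  then have "((p - 1) * J + k * b powr p) / A \<le> p * J / z / A"
    using A0 by (intro divide_right_mono) auto
  then have "((p - 1) * J + k * b powr p) / A \<le> p * ((J / A) / z)" by (simp add: mult_ac)
  moreover have "((p - 1) * J + k * b powr p) / A = (p - 1) * z powr p + q"
    by (simp add: q_eq z add_divide_distrib)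
  moreover have "(J / A) / z = z powr (p - 1)"
    using z by (simp add: powr_diff)
  ultimately have "(p - 1) * z powr p + q \<le> p * z powr (p - 1)" by (simp only:)
  then have "q \<le> H_fun p z" by (simp add: H_fun_def algebra_simps)
  then have "z \<le> omega_fun p q" using le_omega_fun assms q by auto
  then have "z powr p \<le> omega_fun p q powr p" using z assms by (intro powr_mono2) auto
  then have "J \<le> A * omega_fun p q powr p" using z A0 by (simp add: field_simps)
  then show "J \<le> candidate p f F k (b * k)"
    using A0 unfolding candidate_def Let_def A_def[symmetric] q_def by simp
qed

lemma nn_integral_powr_interval:
  assumes "0 < b" "b \<le> y" "s > 0"
  shows "(\<integral>\<^sup>+l. ennreal (s * l powr (s - 1)) * indicator {b..<y} l \<partial>lborel) = ennreal (y powr s - b powr s)"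
proof -
  have "(\<integral>\<^sup>+l. ennreal (s * l powr (s - 1)) * indicator {b..<y} l \<partial>lborel)
      = (\<integral>\<^sup>+l. ennreal (s * l powr (s - 1)) * indicator {b..y} l \<partial>lborel)"
    by (intro nn_integral_cong_AE)
       (use AE_lborel_singleton[of y] in \<open>eventually_elim, auto simp: indicator_def\<close>)
  also have "\<dots> = ennreal (y powr s - b powr s)"
    using assms by (intro nn_integral_FTC_Icc[where F = "\<lambda>l. l powr s"])
      (auto intro!: derivative_eq_intros)
  finally show ?thesis .
qed

text \<open>Integrate the distributional inequality against \<open>p (p - 1) l ^ (p - 2)\<close> over \<open>l \<ge> b\<close>.\<close>

lemma (in prob_space) layer_cake_inequality:
  fixes \<phi> g :: "'a \<Rightarrow> real"
  assumes [measurable]: "\<phi> \<in> borel_measurable M" "g \<in> borel_measurable M"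
    and nonneg: "\<And>x. x \<in> space M \<Longrightarrow> 0 \<le> \<phi> x"
    and p: "p > 1" and b: "b > 0"
    and weak: "\<And>l. l > 0 \<Longrightarrow> ennreal l * emeasure M {x \<in> space M. l < g x}
        \<le> (\<integral>\<^sup>+x\<in>{x \<in> space M. l < g x}. ennreal (\<phi> x) \<partial>M)"
  shows "(\<integral>\<^sup>+x. ennreal ((p - 1) * (max (g x) b powr p - b powr p)) \<partial>M)
      \<le> (\<integral>\<^sup>+x. ennreal (p * (\<phi> x * (max (g x) b powr (p - 1) - b powr (p - 1)))) \<partial>M)"
proof -
  interpret pair_sigma_finite M lborel ..
  \<comment> \<open>For \<open>y < b\<close> both sides vanish, so the maximum with \<open>b\<close>
    becomes a plain restriction to levels \<open>l \<ge> b\<close>.\<close>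
  have ind: "(indicator {b..<max y b} l :: ennreal) = indicator {b..} l * indicator {..<y} l" for y l :: real
    by (auto simp: indicator_def)
  have ind': "(indicator {..<g x} l :: ennreal) = indicator {x \<in> space M. l < g x} x" if "x \<in> space M" for x l
    using that by (auto simp: indicator_def)
  \<comment> \<open>Writes a difference of powers as an integral over levels; used with
    \<open>s = p\<close>, \<open>c = p - 1\<close> on the left and \<open>s = p - 1\<close>,
    \<open>c = p * \<phi> x\<close> on the right.\<close>
  have inner: "ennreal (c * (max y b powr s - b powr s))
      = (\<integral>\<^sup>+l. ennreal (c * (s * l powr (s - 1))) * (indicator {b..} l * indicator {..<y} l) \<partial>lborel)"
    if "s > 0" "c \<ge> 0" for s y c
  proof -
    have "ennreal (c * (max y b powr s - b powr s)) = ennreal c * ennreal (max y b powr s - b powr s)"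
      using that by (intro ennreal_mult) (auto intro!: powr_mono2 simp: b less_imp_le[OF b])
    also have "ennreal (max y b powr s - b powr s)
        = (\<integral>\<^sup>+l. ennreal (s * l powr (s - 1)) * indicator {b..<max y b} l \<partial>lborel)"
      by (rule nn_integral_powr_interval[symmetric]) (use b that in auto)
    also have "ennreal c * \<dots> = (\<integral>\<^sup>+l. ennreal c * (ennreal (s * l powr (s - 1)) * indicator {b..<max y b} l) \<partial>lborel)"
      by (rule nn_integral_cmult[symmetric]) measurable
    also have "\<dots> = (\<integral>\<^sup>+l. ennreal (c * (s * l powr (s - 1))) * (indicator {b..} l * indicator {..<y} l) \<partial>lborel)"
      unfolding ind using that by (intro nn_integral_cong) (simp add: ennreal_mult mult.assoc)
    finally show ?thesis .
  qed
  have "(\<integral>\<^sup>+x. ennreal ((p - 1) * (max (g x) b powr p - b powr p)) \<partial>M)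
     = (\<integral>\<^sup>+x. \<integral>\<^sup>+l. ennreal ((p - 1) * (p * l powr (p - 1))) * (indicator {b..} l * indicator {..<g x} l) \<partial>lborel \<partial>M)"
    using p by (intro nn_integral_cong inner) auto
  also have "\<dots> = (\<integral>\<^sup>+l. \<integral>\<^sup>+x. ennreal ((p - 1) * (p * l powr (p - 1))) * (indicator {b..} l * indicator {..<g x} l) \<partial>M \<partial>lborel)"
    by (rule Fubini'[symmetric]) (auto simp: indicator_def lessThan_def)
  also have "\<dots> \<le> (\<integral>\<^sup>+l. \<integral>\<^sup>+x. ennreal (p * \<phi> x * ((p - 1) * l powr (p - 1 - 1))) * (indicator {b..} l * indicator {..<g x} l) \<partial>M \<partial>lborel)"
  proof (rule nn_integral_mono)
    fix l :: real
    show "(\<integral>\<^sup>+x. ennreal ((p - 1) * (p * l powr (p - 1))) * (indicator {b..} l * indicator {..<g x} l) \<partial>M)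
      \<le> (\<integral>\<^sup>+x. ennreal (p * \<phi> x * ((p - 1) * l powr (p - 1 - 1))) * (indicator {b..} l * indicator {..<g x} l) \<partial>M)"
    proof (cases "b \<le> l")
      case True
      then have l: "l > 0" using b by simp
      \<comment> \<open>Both sides carry the weight \<open>p * (p - 1) * l powr (p - 2)\<close>; the
        extra factor \<open>l\<close> on the left is the one in the weak type inequality.\<close>
      have pw: "l powr (p - 1) = l powr (p - 2) * l" using l powr_add[of l "p - 2" 1] by simp
      define c where "c = ennreal (p * (p - 1) * l powr (p - 2))"
      have "(\<integral>\<^sup>+x. ennreal ((p - 1) * (p * l powr (p - 1))) * (indicator {b..} l * indicator {..<g x} l) \<partial>M)
        = (\<integral>\<^sup>+x. (c * ennreal l) * indicator {x \<in> space M. l < g x} x \<partial>M)"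
        using True l p by (intro nn_integral_cong) (simp add: ind' c_def pw mult_ac flip: ennreal_mult)
      also have "\<dots> = c * (ennreal l * emeasure M {x \<in> space M. l < g x})"
        by (subst nn_integral_cmult_indicator) (auto simp: mult.assoc)
      also have "\<dots> \<le> c * (\<integral>\<^sup>+x\<in>{x \<in> space M. l < g x}. ennreal (\<phi> x) \<partial>M)"
        using weak[OF l] by (rule mult_left_mono) simp
      also have "\<dots> = (\<integral>\<^sup>+x. c * (ennreal (\<phi> x) * indicator {x \<in> space M. l < g x} x) \<partial>M)"
        by (rule nn_integral_cmult[symmetric]) measurable
      also have "\<dots> = (\<integral>\<^sup>+x. ennreal (p * \<phi> x * ((p - 1) * l powr (p - 1 - 1))) * (indicator {b..} l * indicator {..<g x} l) \<partial>M)"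
      proof (intro nn_integral_cong)
        fix x assume x: "x \<in> space M"
        have "c * ennreal (\<phi> x) = ennreal (p * (p - 1) * l powr (p - 2) * \<phi> x)"
          unfolding c_def using p nonneg[OF x] by (intro ennreal_mult[symmetric]) auto
        also have "\<dots> = ennreal (p * \<phi> x * ((p - 1) * l powr (p - 1 - 1)))" by (simp add: mult_ac)
        finally show "c * (ennreal (\<phi> x) * indicator {x \<in> space M. l < g x} x)
          = ennreal (p * \<phi> x * ((p - 1) * l powr (p - 1 - 1))) * (indicator {b..} l * indicator {..<g x} l)"
          using True x by (simp add: ind' flip: mult.assoc)
      qed
      finally show ?thesis .
    qed simp
  qed
  also have "\<dots> = (\<integral>\<^sup>+x. \<integral>\<^sup>+l. ennreal (p * \<phi> x * ((p - 1) * l powr (p - 1 - 1))) * (indicator {b..} l * indicator {..<g x} l) \<partial>lborel \<partial>M)"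
    by (rule Fubini') (auto simp: indicator_def lessThan_def)
  also have "\<dots> = (\<integral>\<^sup>+x. ennreal (p * \<phi> x * (max (g x) b powr (p - 1) - b powr (p - 1))) \<partial>M)"
    using p nonneg by (intro nn_integral_cong inner[symmetric]) auto
  finally show ?thesis by (simp add: mult.assoc)
qed

section \<open>The upper bound\<close>

context maximal_tree
begin

context
  fixes \<phi> :: "'a \<Rightarrow> real"
  assumes phi_meas [measurable]: "\<phi> \<in> borel_measurable M"
    and phi_nonneg: "\<And>x. x \<in> space M \<Longrightarrow> 0 \<le> \<phi> x"
    and phi_int: "integrable M \<phi>"
begin

section \<open>Averages, measurability and weak type bound of the maximal function\<close>

abbreviation avg :: "'a set \<Rightarrow> real" where
  "avg I \<equiv> (LINT y:I|M. \<phi> y) / measure M I"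

abbreviation maxf :: "'a \<Rightarrow> ennreal" where
  "maxf \<equiv> tree_maximal M T \<phi>"

lemma set_integral_phi_nonneg: "0 \<le> (LINT x:S|M. \<phi> x)"
  unfolding set_lebesgue_integral_def
  using phi_nonneg by (intro integral_nonneg_AE) (auto simp: indicator_def)

lemma set_integrable_phi: "S \<in> sets M \<Longrightarrow> set_integrable M S \<phi>"
  using phi_int by (rule integrable_set_integrable)

lemma set_nn_integral_phi:
  "S \<in> sets M \<Longrightarrow> (\<integral>\<^sup>+y\<in>S. ennreal (\<phi> y) \<partial>M) = ennreal (LINT y:S|M. \<phi> y)"
  by (intro ennreal_nn_integral_indicator phi_nonneg set_integrable_phi)

lemma nn_avg_eq:
  assumes "I \<in> T"
  shows "(\<integral>\<^sup>+y\<in>I. ennreal \<bar>\<phi> y\<bar> \<partial>M) / emeasure M I = ennreal (avg I)"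
proof -
  have "(\<integral>\<^sup>+y\<in>I. ennreal \<bar>\<phi> y\<bar> \<partial>M) = (\<integral>\<^sup>+y\<in>I. ennreal (\<phi> y) \<partial>M)"
    by (intro nn_integral_cong) (simp add: phi_nonneg)
  also have "\<dots> = ennreal (LINT y:I|M. \<phi> y)"
    using assms by (intro set_nn_integral_phi) simp
  finally show ?thesis
    using T_pos[OF assms] set_integral_phi_nonneg[of I]
    by (simp add: emeasure_eq_measure divide_ennreal)
qed

lemma avg_le_maxf: "I \<in> T \<Longrightarrow> x \<in> I \<Longrightarrow> ennreal (avg I) \<le> maxf x"
  unfolding tree_maximal_def by (rule SUP_upper2[of I]) (auto simp: nn_avg_eq)

lemma less_maxf_iff:
  assumes "0 \<le> l"
  shows "ennreal l < maxf x \<longleftrightarrow> (\<exists>I\<in>T. x \<in> I \<and> l < avg I)"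
  unfolding tree_maximal_def less_SUP_iff
  by (auto simp: nn_avg_eq ennreal_less_iff assms)

text \<open>The supremum over the tree sets through \<open>x\<close>, an index set depending on
  \<open>x\<close>, is rewritten as one over the countable \<open>T\<close> by means of
  indicators.\<close>

lemma maxf_measurable [measurable]: "maxf \<in> borel_measurable M"
proof -
  have "maxf x = (SUP I\<in>T. ennreal (avg I) * indicator I x)" for x
  proof (rule antisym)
    show "maxf x \<le> (SUP I\<in>T. ennreal (avg I) * indicator I x)"
      unfolding tree_maximal_def
      by (rule SUP_least) (auto simp: nn_avg_eq intro!: SUP_upper2)
    show "(SUP I\<in>T. ennreal (avg I) * indicator I x) \<le> maxf x"
      by (rule SUP_least) (auto simp: indicator_def intro!: avg_le_maxf)
  qed
  then have "maxf = (\<lambda>x. SUP I\<in>T. ennreal (avg I) * indicator I x)" by auto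
  moreover have "(\<lambda>x. SUP I\<in>T. ennreal (avg I) * indicator I x) \<in> borel_measurable M"
    by (rule borel_measurable_SUP[OF countable_T]) measurable
  ultimately show ?thesis by simp
qed

lemma mean_le_maxf: "x \<in> space M \<Longrightarrow> ennreal (integral\<^sup>L M \<phi>) \<le> maxf x"
  using avg_le_maxf[OF space_in_T, of x] prob_space set_integral_space[OF phi_int] by simp

text \<open>The superlevel set is the union of the tree sets with average above \<open>l\<close>. A
  disjoint subfamily has the same union, and the averages can be summed over it.\<close>

lemma maxf_weak_type:
  assumes "0 \<le> l"
  shows "ennreal l * emeasure M {x \<in> space M. ennreal l < maxf x}
      \<le> (\<integral>\<^sup>+x\<in>{x \<in> space M. ennreal l < maxf x}. ennreal (\<phi> x) \<partial>M)"
proof -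
  define \<G> where "\<G> = {I \<in> T. l < avg I}"
  obtain \<S> where S: "\<S> \<subseteq> \<G>" "disjoint \<S>" "\<Union>\<S> = \<Union>\<G>"
    using ex_disjoint_subfamily[of \<G>] by (auto simp: \<G>_def)
  have ST: "\<S> \<subseteq> T" using S by (auto simp: \<G>_def)
  have eq: "{x \<in> space M. ennreal l < maxf x} = (\<Union>I\<in>\<S>. I)"
  proof -
    have "I \<subseteq> space M" if "I \<in> T" for I using that by (simp add: sets.sets_into_space)
    then have "{x \<in> space M. ennreal l < maxf x} = \<Union>\<G>"
      unfolding \<G>_def less_maxf_iff[OF assms] by blast
    then show ?thesis using S by simp
  qed
  have cS: "countable \<S>" using countable_subset[OF ST countable_T] .
  have disj: "disjoint_family_on (\<lambda>I. I) \<S>"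
    using S(2) by (auto simp: disjoint_family_on_def dest: disjointD)
  have mS: "I \<in> sets M" if "I \<in> \<S>" for I using that ST T_sets by blast
  define \<nu> where "\<nu> = density M (\<lambda>x. ennreal (\<phi> x))"
  have "ennreal l * emeasure M (\<Union>I\<in>\<S>. I) = ennreal l * (\<integral>\<^sup>+I. emeasure M I \<partial>count_space \<S>)"
    by (subst emeasure_UN_countable[OF mS cS disj]) auto
  also have "\<dots> = (\<integral>\<^sup>+I. ennreal l * emeasure M I \<partial>count_space \<S>)"
    by (rule nn_integral_cmult[symmetric]) simp
  also have "\<dots> \<le> (\<integral>\<^sup>+I. emeasure \<nu> I \<partial>count_space \<S>)"
  proof (rule nn_integral_mono)
    fix I assume "I \<in> space (count_space \<S>)"
    then have I: "I \<in> T" "l < avg I" "I \<in> sets M" using S mS by (auto simp: \<G>_def)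
    have "l * measure M I \<le> (LINT y:I|M. \<phi> y)"
      using I T_pos[of I] by (simp add: pos_less_divide_eq less_imp_le)
    then have "ennreal l * emeasure M I \<le> ennreal (LINT y:I|M. \<phi> y)"
      using assms by (simp add: emeasure_eq_measure ennreal_leI flip: ennreal_mult)
    then show "ennreal l * emeasure M I \<le> emeasure \<nu> I"
      unfolding \<nu>_def using I by (simp add: emeasure_density set_nn_integral_phi)
  qed
  also have "\<dots> = emeasure \<nu> (\<Union>I\<in>\<S>. I)"
    by (rule emeasure_UN_countable[symmetric, OF _ cS disj]) (simp add: \<nu>_def mS)
  also have "\<dots> = (\<integral>\<^sup>+x\<in>(\<Union>I\<in>\<S>. I). ennreal (\<phi> x) \<partial>M)"
    unfolding \<nu>_def using Union_measurable[OF ST] by (subst emeasure_density) auto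
  finally show ?thesis unfolding eq .
qed

lemma maxf_weak_type_real:
  assumes "0 \<le> l"
  shows "l * measure M {x \<in> space M. ennreal l < maxf x}
      \<le> (LINT x:{x \<in> space M. ennreal l < maxf x}|M. \<phi> x)"
proof -
  have "ennreal (l * measure M {x \<in> space M. ennreal l < maxf x})
      \<le> ennreal (LINT x:{x \<in> space M. ennreal l < maxf x}|M. \<phi> x)"
    using maxf_weak_type[OF assms] set_nn_integral_phi[of "{x \<in> space M. ennreal l < maxf x}"] assms
    by (simp add: emeasure_eq_measure ennreal_mult)
  then show ?thesis using set_integral_phi_nonneg by (simp add: ennreal_le_iff)
qed

text \<open>At a point of differentiation, \<open>\<phi> x\<close> is the limit of the averages over
  the sets of each level containing \<open>x\<close>, and all of these are at most
  \<open>maxf x\<close>.\<close>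

lemma phi_le_maxf: "AE x in M. ennreal (\<phi> x) \<le> maxf x"
proof -
  have "AE x in M. ((\<lambda>I. (1 / measure M I) * (LINT y:I|M. \<phi> y)) \<longlongrightarrow> \<phi> x) (shrinking_to M T x)"
    using T_diff phi_int unfolding differentiates_L1_def by blast
  then show ?thesis
  proof (rule AE_mp, intro AE_I2 impI)
    fix x assume x: "x \<in> space M"
      and lim: "((\<lambda>I. (1 / measure M I) * (LINT y:I|M. \<phi> y)) \<longlongrightarrow> \<phi> x) (shrinking_to M T x)"
    have "\<forall>m. \<exists>I. I \<in> lev m \<and> x \<in> I" using Union_lev x by blast
    then obtain J where J: "\<And>m. J m \<in> lev m" "\<And>m. x \<in> J m" by metis
    have JT: "J m \<in> T" for m using J lev_subset by blast
    have "measure M (J m) \<le> (SUP I\<in>lev m. measure M I)" for m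
      by (rule cSUP_upper[OF J(1)]) (intro bdd_aboveI[of _ 1], auto)
    then have "(\<lambda>m. measure M (J m)) \<longlonglongrightarrow> 0"
      by (intro tendsto_sandwich[OF _ _ tendsto_const level_tendsto]) auto
    then have "filterlim (\<lambda>m. measure M (J m)) (at_right 0) sequentially"
      unfolding filterlim_at using T_pos[OF JT]
      by (auto intro!: always_eventually simp: order_less_le)
    then have "filterlim J (shrinking_to M T x) sequentially"
      unfolding shrinking_to_def
      by (auto simp: filterlim_inf filterlim_filtercomap_iff o_def filterlim_principal J JT)
    from filterlim_compose[OF lim this] have "(\<lambda>m. avg (J m)) \<longlonglongrightarrow> \<phi> x" by simp
    then have "(\<lambda>m. ennreal (avg (J m))) \<longlonglongrightarrow> ennreal (\<phi> x)" by (rule tendsto_ennrealI)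
    then show "ennreal (\<phi> x) \<le> maxf x"
      by (rule LIMSEQ_le_const2) (use avg_le_maxf[OF JT J(2)] in blast)
  qed
qed

text \<open>Here \<open>K\<close> lies between \<open>{maxf > c}\<close> and \<open>{maxf \<ge> c}\<close> for the appropriate quantile \<open>c\<close>. As
  \<open>\<phi> \<le> c\<close> almost everywhere on \<open>{maxf = c}\<close>, the mean of \<open>\<phi>\<close> over \<open>K\<close> is at least its mean over
  \<open>{maxf \<ge> c}\<close>, which is at least \<open>c\<close> by the weak type inequality.\<close>

lemma ex_superlevel_set:
  assumes k: "0 < k" "k < 1" and f: "0 < integral\<^sup>L M \<phi>"
  shows "\<exists>K\<in>sets M. \<exists>b. integral\<^sup>L M \<phi> \<le> b \<and> measure M K = k \<and> (LINT x:K|M. \<phi> x) = b * k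
     \<and> {x \<in> space M. ennreal b < maxf x} \<subseteq> K"
proof -
  define G where "G l = {x \<in> space M. ennreal l < maxf x}" for l
  have [measurable]: "G l \<in> sets M" for l unfolding G_def by measurable
  have weak: "0 \<le> l \<Longrightarrow> l * measure M (G l) \<le> (LINT x:G l|M. \<phi> x)" for l
    unfolding G_def by (rule maxf_weak_type_real)
  have G_mono: "l \<le> l' \<Longrightarrow> G l' \<subseteq> G l" for l l'
    unfolding G_def by (auto intro: ennreal_leI le_less_trans)
  \<comment> \<open>\<open>c\<close> is the quantile of \<open>maxf\<close> at which the measure of
    the strict superlevel set drops to at most \<open>k\<close>.\<close>
  define \<Lambda> where "\<Lambda> = {l. 0 \<le> l \<and> measure M (G l) \<le> k}"
  define c where "c = Inf \<Lambda>"
  let ?f = "integral\<^sup>L M \<phi>"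
  have "?f / k \<in> \<Lambda>"
  proof -
    have "(LINT x:G (?f / k)|M. \<phi> x) \<le> ?f"
      unfolding set_lebesgue_integral_def
      using set_integrable_phi[of "G (?f / k)"] phi_nonneg
      by (intro integral_mono_AE phi_int AE_I2) (auto simp: indicator_def set_integrable_def)
    with weak[of "?f / k"] f k have "?f / k * measure M (G (?f / k)) \<le> ?f" by simp
    then show ?thesis using f k by (simp add: \<Lambda>_def field_simps)
  qed
  then have ne: "\<Lambda> \<noteq> {}" by blast
  have bdd: "bdd_below \<Lambda>" by (rule bdd_belowI[of _ 0]) (auto simp: \<Lambda>_def)
  have fc: "?f \<le> c"
    unfolding c_def
  proof (rule cInf_greatest[OF ne], rule ccontr)
    fix l assume l: "l \<in> \<Lambda>" "\<not> ?f \<le> l"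
    then have "ennreal l < ennreal ?f" by (auto simp: \<Lambda>_def ennreal_less_iff)
    then have "G l = space M" unfolding G_def using mean_le_maxf by (auto intro: less_le_trans)
    then show False using l k prob_space by (simp add: \<Lambda>_def)
  qed
  have c0: "0 < c" using fc f by simp
  have Gc: "measure M (G c) \<le> k"
  proof -
    \<comment> \<open>Continuity from the right: the strict superlevel sets increase to
      \<open>G c\<close> as the level decreases to \<open>c\<close>, so the infimum \<open>c\<close>
      inherits the bound \<open>k\<close>.\<close>
    have eq: "(\<Union>n. G (c + 1 / real (Suc n))) = G c"
    proof
      show "(\<Union>n. G (c + 1 / real (Suc n))) \<subseteq> G c" by (rule UN_least, rule G_mono) simp
      show "G c \<subseteq> (\<Union>n. G (c + 1 / real (Suc n)))"
      proof
        fix x assume x: "x \<in> G c"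
        obtain r where r: "c < r" "ennreal r < maxf x"
        proof (cases "maxf x")
          case (real s)
          then have "c < s" using x c0 by (simp add: G_def ennreal_less_iff)
          then show thesis using dense[of c s] that real c0 by (auto simp: ennreal_less_iff)
        next
          case top
          then show thesis using that[of "c + 1"] by simp
        qed
        then obtain n where "inverse (real (Suc n)) < r - c" using reals_Archimedean[of "r - c"] by auto
        then have "c + 1 / real (Suc n) \<le> r" by (simp add: inverse_eq_divide)
        then have "ennreal (c + 1 / real (Suc n)) < maxf x" using r by (auto intro: ennreal_leI le_less_trans)
        then show "x \<in> (\<Union>n. G (c + 1 / real (Suc n)))" using x by (auto simp: G_def)
      qed
    qed
    have lim: "(\<lambda>n. measure M (G (c + 1 / real (Suc n)))) \<longlonglongrightarrow> measure M (\<Union>n. G (c + 1 / real (Suc n)))"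
      by (rule finite_Lim_measure_incseq) (auto intro!: incseq_SucI G_mono simp: frac_le)
    have "measure M (G (c + 1 / real (Suc n))) \<le> k" for n
    proof -
      have "c < c + 1 / real (Suc n)" by simp
      then obtain l where "l \<in> \<Lambda>" "l < c + 1 / real (Suc n)"
        unfolding c_def using cInf_lessD[OF ne] by blast
      then have "measure M (G (c + 1 / real (Suc n))) \<le> measure M (G l)" "measure M (G l) \<le> k"
        by (auto simp: \<Lambda>_def intro!: finite_measure_mono G_mono)
      then show ?thesis by simp
    qed
    then show ?thesis by (intro LIMSEQ_le_const2[OF lim[unfolded eq]]) blast
  qed
  define D where "D = {x \<in> space M. ennreal c \<le> maxf x}"
  have [measurable]: "D \<in> sets M" unfolding D_def by measurable
  \<comment> \<open>The levels \<open>s n\<close> rise strictly to \<open>c\<close> from below,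
    starting at 0. Their strict superlevel sets shrink to \<open>D\<close>, which carries the weak
    type inequality over to the non-strict set.\<close>
  define s where "s n = c * (1 - 1 / real (Suc n))" for n
  have s: "0 \<le> s n" "s n < c" for n using c0 by (auto simp: s_def field_simps)
  have s_lim: "s \<longlonglongrightarrow> c"
  proof -
    have "(\<lambda>n. c * (1 - 1 / real (Suc n))) \<longlonglongrightarrow> c * (1 - 0)"
      using LIMSEQ_inverse_real_of_nat by (intro tendsto_intros) (simp add: inverse_eq_divide)
    then show ?thesis by (simp add: s_def[abs_def])
  qed
  have D_eq: "(\<Inter>n. G (s n)) = D"
  proof
    show "D \<subseteq> (\<Inter>n. G (s n))"
    proof (intro INT_greatest subsetI)
      fix n x assume "x \<in> D"
      moreover have "ennreal (s n) < ennreal c" using s[of n] by (simp add: ennreal_less_iff)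
      ultimately show "x \<in> G (s n)" by (auto simp: D_def G_def)
    qed
    show "(\<Inter>n. G (s n)) \<subseteq> D"
    proof
      fix x assume x: "x \<in> (\<Inter>n. G (s n))"
      have "(\<lambda>n. ennreal (s n)) \<longlonglongrightarrow> ennreal c" using s_lim by (rule tendsto_ennrealI)
      then have "ennreal c \<le> maxf x"
        by (rule LIMSEQ_le_const2) (use x in \<open>auto simp: G_def less_imp_le\<close>)
      then show "x \<in> D" using x by (auto simp: D_def G_def)
    qed
  qed
  have dec: "decseq (\<lambda>n. G (s n))"
    by (rule decseq_SucI, rule G_mono) (use c0 in \<open>auto simp: s_def frac_le intro!: mult_left_mono\<close>)
  have meas_lim: "(\<lambda>n. measure M (G (s n))) \<longlonglongrightarrow> measure M D"
    unfolding D_eq[symmetric] by (rule finite_Lim_measure_decseq[OF _ dec]) auto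
  have Gs: "k \<le> measure M (G (s n))" for n
  proof (rule ccontr)
    assume "\<not> k \<le> measure M (G (s n))"
    then have "s n \<in> \<Lambda>" using s by (auto simp: \<Lambda>_def)
    then have "c \<le> s n" unfolding c_def using bdd by (rule cInf_lower)
    then show False using s[of n] by simp
  qed
  have kD: "k \<le> measure M D" by (rule LIMSEQ_le_const[OF meas_lim]) (use Gs in blast)
  have D_mean: "c * measure M D \<le> (LINT x:D|M. \<phi> x)"
  proof (rule LIMSEQ_le)
    show "(\<lambda>n. s n * measure M (G (s n))) \<longlonglongrightarrow> c * measure M D"
      by (intro tendsto_mult s_lim meas_lim)
    show "(\<lambda>n. LINT x:G (s n)|M. \<phi> x) \<longlonglongrightarrow> (LINT x:D|M. \<phi> x)"
      unfolding D_eq[symmetric] by (rule set_integral_cont_down[OF _ dec]) (auto intro: set_integrable_phi)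
  qed (use weak s in blast)
  have "G c \<subseteq> D" by (auto simp: G_def D_def)
  then obtain K where K: "K \<in> sets M" "G c \<subseteq> K" "K \<subseteq> D" "measure M K = k"
    using ex_subset_measure[of D "G c" k] Gc kD by auto
  note [measurable] = K(1)
  have cst: "set_integrable M S (\<lambda>x. c)" if "S \<in> sets M" for S
    using that by (intro set_integrable_bounded[of _ _ "\<bar>c\<bar>"]) auto
  have "(LINT x:D - K|M. \<phi> x) \<le> (LINT x:D - K|M. c)"
  proof (rule set_integral_mono_AE)
    show "AE x\<in>D - K in M. \<phi> x \<le> c"
      using phi_le_maxf
    proof eventually_elim
      case (elim x)
      show ?case
      proof
        assume x: "x \<in> D - K"
        then have "maxf x \<le> ennreal c" using K(2) by (auto simp: G_def D_def not_less)
        then have "ennreal (\<phi> x) \<le> ennreal c" using elim by (rule order_trans[rotated])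
        then show "\<phi> x \<le> c" using c0 by (simp add: ennreal_le_iff)
      qed
    qed
  qed (auto intro!: set_integrable_phi cst)
  also have "\<dots> = c * measure M (D - K)" by (simp add: set_lebesgue_integral_def)
  also have "measure M (D - K) = measure M D - k" using K finite_measure_Diff[of D K] by simp
  finally have DK: "(LINT x:D - K|M. \<phi> x) \<le> c * (measure M D - k)" .
  have "(LINT x:D|M. \<phi> x) = (LINT x:K \<union> (D - K)|M. \<phi> x)" using K(3) by (simp add: Un_absorb1)
  also have "\<dots> = (LINT x:K|M. \<phi> x) + (LINT x:D - K|M. \<phi> x)"
    by (rule set_integral_Un) (auto intro!: set_integrable_phi)
  finally have cK: "c * k \<le> (LINT x:K|M. \<phi> x)" using DK D_mean by (simp add: algebra_simps)
  \<comment> \<open>The superlevel set at the mean \<open>b\<close> of \<open>\<phi>\<close> over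
    \<open>K\<close> is contained in \<open>K\<close>, because \<open>b \<ge> c\<close>.\<close>
  define b where "b = (LINT x:K|M. \<phi> x) / k"
  have b: "c \<le> b" "(LINT x:K|M. \<phi> x) = b * k" using cK k by (auto simp: b_def pos_le_divide_eq)
  then have "G b \<subseteq> K" using G_mono[of c b] K(2) by blast
  then show ?thesis using K b fc by (intro bexI[of _ K] exI[of _ b]) (auto simp: G_def)
qed

text \<open>Truncating \<open>maxf\<close> at \<open>c\<close> makes all integrals finite, so that
  the layer cake inequality can be rearranged; the resulting bound does not depend on
  \<open>c\<close>.\<close>

lemma maxf_truncated_le_candidate:
  fixes p k b c :: real
  assumes p: "p > 1" and k: "0 < k" "k < 1"
    and f: "0 < integral\<^sup>L M \<phi>" and F: "integrable M (\<lambda>x. \<phi> x powr p)"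
    and K [measurable]: "K \<in> sets M" "measure M K = k"
    and b: "0 < b" "(LINT x:K|M. \<phi> x) = b * k" "{x \<in> space M. ennreal b < maxf x} \<subseteq> K"
    and c: "b \<le> c"
    and K0 [measurable]: "K0 \<in> sets M" "measure M K0 = k"
  defines "f \<equiv> integral\<^sup>L M \<phi>" and "F \<equiv> integral\<^sup>L M (\<lambda>x. \<phi> x powr p)"
  shows "h_fun p f k (b * k) \<le> F"
    and "(\<integral>\<^sup>+x\<in>K0. ennreal (enn2real (min (maxf x) (ennreal c)) powr p) \<partial>M)
      \<le> ennreal (candidate p f F k (b * k))"
proof -
  define u where "u x = enn2real (min (maxf x) (ennreal c))" for x
  have um [measurable]: "u \<in> borel_measurable M" unfolding u_def by measurable
  have c0: "0 < c" using b c by simp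
  have ennu: "ennreal (u x) = min (maxf x) (ennreal c)" for x
    unfolding u_def by (rule ennreal_enn2real) (simp add: min_less_iff_disj)
  have u: "0 \<le> u x" "u x \<le> c" for x
  proof -
    show "0 \<le> u x" by (simp add: u_def)
    have "ennreal (u x) \<le> ennreal c" unfolding ennu by simp
    then show "u x \<le> c" using c0 by (simp add: ennreal_le_iff)
  qed
  have less_u: "l < u x \<longleftrightarrow> l < c \<and> ennreal l < maxf x" if "0 \<le> l" for l x
  proof -
    have "l < u x \<longleftrightarrow> ennreal l < ennreal (u x)" using that by (simp add: ennreal_less_iff)
    then show ?thesis unfolding ennu using that by (auto simp: ennreal_less_iff)
  qed
  \<comment> \<open>Truncation preserves the weak type inequality: below \<open>c\<close> the
    superlevel sets of \<open>u\<close> and \<open>maxf\<close> coincide, and from \<open>c\<close>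
    on those of \<open>u\<close> are empty.\<close>
  have weak: "ennreal l * emeasure M {x \<in> space M. l < u x}
      \<le> (\<integral>\<^sup>+x\<in>{x \<in> space M. l < u x}. ennreal (\<phi> x) \<partial>M)" if "l > 0" for l
  proof (cases "l < c")
    case True
    then show ?thesis using maxf_weak_type[of l] that by (simp add: less_u)
  next
    case False
    then have "\<not> l < u x" for x using u(2)[of x] by simp
    then show ?thesis by simp
  qed
  define g where "g x = max (u x) b" for x
  have gm [measurable]: "g \<in> borel_measurable M" unfolding g_def by measurable
  have g: "b \<le> g x" "g x \<le> c" "0 \<le> g x" for x using u[of x] c b by (auto simp: g_def)
  have g_off: "g x = b" if "x \<in> space M - K" for x
    using b(1,3) that less_u[of b x] by (auto simp: g_def max_def not_le)
  have gp: "\<bar>g x powr s\<bar> \<le> c powr s" "b powr s \<le> g x powr s" if "s > 0" for x s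
    using that g[of x] b by (auto intro!: powr_mono2)
  have ig: "integrable M (\<lambda>x. g x powr s)" if "s > 0" for s
    by (rule integrable_const_bound[of _ "c powr s"]) (use gp[OF that] in auto)
  have ipg: "integrable M (\<lambda>x. \<phi> x * g x powr (p - 1))"
  proof (rule Bochner_Integration.integrable_bound)
    show "integrable M (\<lambda>x. \<phi> x * c powr (p - 1))" using phi_int by simp
    show "AE x in M. norm (\<phi> x * g x powr (p - 1)) \<le> norm (\<phi> x * c powr (p - 1))"
      using gp[of "p - 1"] p by (auto simp: abs_mult intro!: mult_left_mono)
  qed measurable
  define J Y where "J = (LINT x:K|M. g x powr p)" and "Y = (LINT x:K|M. \<phi> x * g x powr (p - 1))"
  note iK = integrable_set_integrable[OF _ K(1)]
  have cst: "set_integrable M S (\<lambda>x. r)" if "S \<in> sets M" for S and r :: real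
    using that by (intro set_integrable_bounded[of _ _ "\<bar>r\<bar>"]) auto
  have intK: "integral\<^sup>L M h = (LINT x:K|M. h x)"
    if "\<And>x. x \<in> space M - K \<Longrightarrow> h x = 0" for h :: "'a \<Rightarrow> real"
    unfolding set_lebesgue_integral_def
    by (rule Bochner_Integration.integral_cong) (use that in \<open>auto simp: indicator_def\<close>)
  have L: "(\<integral>x. g x powr p - b powr p \<partial>M) = J - k * b powr p"
  proof -
    have "(\<integral>x. g x powr p - b powr p \<partial>M) = (LINT x:K|M. g x powr p - b powr p)"
      by (rule intK) (simp add: g_off)
    also have "\<dots> = J - (LINT x:K|M. b powr p)"
      unfolding J_def using p by (intro set_integral_diff iK ig cst) auto
    also have "(LINT x:K|M. b powr p) = k * b powr p" by (simp add: set_lebesgue_integral_def K)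
    finally show ?thesis .
  qed
  have bp: "b powr p = b powr (p - 1) * b" using b powr_add[of b "p - 1" 1] by simp
  \<comment> \<open>Since \<open>b\<close> is the mean of \<open>\<phi>\<close> over
    \<open>K\<close>, the correction term is again \<open>k * b powr p\<close>, the same as in
    \<open>L\<close>.\<close>
  have R: "(\<integral>x. \<phi> x * (g x powr (p - 1) - b powr (p - 1)) \<partial>M) = Y - k * b powr p"
  proof -
    have "(\<integral>x. \<phi> x * (g x powr (p - 1) - b powr (p - 1)) \<partial>M)
      = (LINT x:K|M. \<phi> x * (g x powr (p - 1) - b powr (p - 1)))"
      by (rule intK) (simp add: g_off)
    also have "\<dots> = (LINT x:K|M. \<phi> x * g x powr (p - 1) - \<phi> x * b powr (p - 1))"
      by (simp add: algebra_simps)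
    also have "\<dots> = Y - (LINT x:K|M. \<phi> x * b powr (p - 1))"
      unfolding Y_def using ipg phi_int by (intro set_integral_diff iK) auto
    also have "(LINT x:K|M. \<phi> x * b powr (p - 1)) = k * b powr p"
      using b(2) by (simp add: bp)
    finally show ?thesis .
  qed
  have "(\<integral>\<^sup>+x. ennreal ((p - 1) * (g x powr p - b powr p)) \<partial>M)
      \<le> (\<integral>\<^sup>+x. ennreal (p * (\<phi> x * (g x powr (p - 1) - b powr (p - 1)))) \<partial>M)"
    unfolding g_def by (rule layer_cake_inequality) (use p b weak phi_nonneg in auto)
  also have "\<dots> = ennreal (\<integral>x. p * (\<phi> x * (g x powr (p - 1) - b powr (p - 1))) \<partial>M)"
    using ipg phi_int gp(2)[of "p - 1"] p phi_nonneg
    by (intro nn_integral_eq_integral) (auto simp: right_diff_distrib intro!: AE_I2 mult_left_mono)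
  also have "(\<integral>\<^sup>+x. ennreal ((p - 1) * (g x powr p - b powr p)) \<partial>M)
      = ennreal (\<integral>x. (p - 1) * (g x powr p - b powr p) \<partial>M)"
    using ig[of p] gp(2)[of p] p
    by (intro nn_integral_eq_integral) auto
  finally have "ennreal ((p - 1) * (J - k * b powr p)) \<le> ennreal (p * (Y - k * b powr p))"
    by (simp only: integral_mult_right_zero L R)
  moreover have "0 \<le> Y - k * b powr p"
    unfolding R[symmetric] using phi_nonneg gp(2)[of "p - 1"] p by (intro integral_nonneg_AE) auto
  ultimately have main: "(p - 1) * J + k * b powr p \<le> p * Y"
    using p by (simp add: ennreal_le_iff algebra_simps)
  have J_ge: "k * b powr p \<le> J"
  proof -
    have "0 \<le> J - k * b powr p"
      unfolding L[symmetric] using gp(2)[of p] p by (intro integral_nonneg_AE) auto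
    then show ?thesis by simp
  qed
  define a a' where "a = (LINT x:K|M. \<phi> x powr p)" and "a' = (LINT x:space M - K|M. \<phi> x powr p)"
  have split: "integral\<^sup>L M h = (LINT x:K|M. h x) + (LINT x:space M - K|M. h x)"
    if "integrable M h" for h :: "'a \<Rightarrow> real"
  proof -
    have "integral\<^sup>L M h = (LINT x:K \<union> (space M - K)|M. h x)"
      using set_integral_space[OF that] sets.sets_into_space[OF K(1)] by (simp add: Un_absorb1)
    also have "\<dots> = (LINT x:K|M. h x) + (LINT x:space M - K|M. h x)"
      using that by (intro set_integral_Un integrable_set_integrable) auto
    finally show ?thesis .
  qed
  have compl: "measure M (space M - K) = 1 - k" using K prob_compl[of K] by simp
  have fB: "(LINT x:space M - K|M. \<phi> x) = f - b * k" using split[OF phi_int] b(2) by (simp add: f_def)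
  have aF: "a + a' = F" using split[OF F] by (simp add: a_def a'_def F_def)
  have a: "(b * k) powr p / k powr (p - 1) \<le> a"
    using set_integral_powr_ge[OF p phi_nonneg K(1) _ phi_int F] K k b(2) by (simp add: a_def)
  have a': "(f - b * k) powr p / (1 - k) powr (p - 1) \<le> a'"
    using set_integral_powr_ge[OF p phi_nonneg _ _ phi_int F, of "space M - K"] k compl fB
    by (simp add: a'_def)
  have young: "p * z * Y \<le> z powr p * a + (p - 1) * J" if z: "z > 0" for z
  proof -
    have "(LINT x:K|M. p * z * (\<phi> x * g x powr (p - 1)))
        \<le> (LINT x:K|M. z powr p * \<phi> x powr p + (p - 1) * g x powr p)"
    proof (rule set_integral_mono)
      fix x assume "x \<in> K"
      then have x: "0 \<le> \<phi> x" using phi_nonneg sets.sets_into_space[OF K(1)] by auto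
      then have "p * (z * \<phi> x) * g x powr (p - 1) \<le> (z * \<phi> x) powr p + (p - 1) * g x powr p"
        using z g(3)[of x] by (intro powr_young p) auto
      then show "p * z * (\<phi> x * g x powr (p - 1)) \<le> z powr p * \<phi> x powr p + (p - 1) * g x powr p"
        using x z by (simp add: powr_mult mult_ac)
    qed (use p ipg F ig in \<open>auto intro!: iK\<close>)
    also have "\<dots> = (LINT x:K|M. z powr p * \<phi> x powr p) + (LINT x:K|M. (p - 1) * g x powr p)"
      using p F ig by (intro set_integral_add iK) auto
    finally show ?thesis by (simp add: Y_def a_def J_def)
  qed
  note cand = candidate_ge[OF p k b(1) aF a a' main young J_ge]
  show "h_fun p f k (b * k) \<le> F" by (rule cand(1))
  have iu: "integrable M (\<lambda>x. u x powr p)"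
    by (rule integrable_const_bound[of _ "c powr p"]) (use u p in \<open>auto intro!: powr_mono2\<close>)
  \<comment> \<open>Comparison of \<open>K0\<close> with \<open>K\<close>:
    \<open>g powr p - b powr p\<close> is nonnegative and vanishes off \<open>K\<close>, so its
    integral over \<open>K0\<close> is at most that over \<open>K\<close>; the constant part agrees
    because both sets have measure \<open>k\<close>.\<close>
  have "(LINT x:K0|M. u x powr p) \<le> (LINT x:K0|M. (g x powr p - b powr p) + b powr p)"
    using iu ig[of p] p u
    by (intro set_integral_mono integrable_set_integrable) (auto intro!: powr_mono2 simp: g_def)
  also have "\<dots> = (LINT x:K0|M. g x powr p - b powr p) + (LINT x:K0|M. b powr p)"
    using ig[of p] p by (intro set_integral_add integrable_set_integrable) auto
  also have "(LINT x:K0|M. b powr p) = k * b powr p" by (simp add: set_lebesgue_integral_def K0)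
  also have "(LINT x:K0|M. g x powr p - b powr p) \<le> (\<integral>x. g x powr p - b powr p \<partial>M)"
    unfolding set_lebesgue_integral_def
    using ig[of p] gp(2)[of p] p integrable_set_integrable[of M "\<lambda>x. g x powr p - b powr p" K0]
    by (intro integral_mono_AE AE_I2) (auto simp: indicator_def set_integrable_def)
  finally have uJ: "(LINT x:K0|M. u x powr p) \<le> J" unfolding L by simp
  have "(\<integral>\<^sup>+x\<in>K0. ennreal (u x powr p) \<partial>M) = ennreal (LINT x:K0|M. u x powr p)"
    using iu by (intro ennreal_nn_integral_indicator integrable_set_integrable) auto
  also have "\<dots> \<le> ennreal (candidate p f F k (b * k))" using uJ cand(2) by (intro ennreal_leI) simp
  finally show "(\<integral>\<^sup>+x\<in>K0. ennreal (enn2real (min (maxf x) (ennreal c)) powr p) \<partial>M)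
      \<le> ennreal (candidate p f F k (b * k))" unfolding u_def .
qed

text \<open>The truncation levels start at \<open>b\<close>, as
  \<open>maxf_truncated_le_candidate\<close> requires. At \<open>y = \<top>\<close> the truncated
  powers exceed every \<open>n\<close>, because \<open>p \<ge> 1\<close>.\<close>

lemma ennreal_powr_eq_SUP:
  assumes "p \<ge> 1" "b > 0"
  shows "ennreal_powr y p = (SUP n. ennreal (enn2real (min y (ennreal (b + real n))) powr p))"
proof (cases y)
  case (real r)
  have "ennreal (enn2real (min y (ennreal (b + real n))) powr p) \<le> ennreal (r powr p)" for n
    using real assms by (intro ennreal_leI powr_mono2 enn2real_leI) auto
  moreover obtain n where "r \<le> real n" using real_arch_simple by blast
  then have "ennreal (enn2real (min y (ennreal (b + real n))) powr p) = ennreal (r powr p)"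
  proof -
    have "ennreal r \<le> ennreal (b + real n)" using \<open>r \<le> real n\<close> assms by (intro ennreal_leI) simp
    then show ?thesis using real by (simp add: min_absorb1)
  qed
  ultimately have "(SUP n. ennreal (enn2real (min y (ennreal (b + real n))) powr p)) = ennreal (r powr p)"
    by (metis (no_types, lifting) SUP_eqI UNIV_I)
  then show ?thesis using real by (simp add: ennreal_powr_def)
next
  case top
  have "(SUP n. of_nat n :: ennreal) \<le> (SUP n. ennreal (enn2real (min y (ennreal (b + real n))) powr p))"
  proof (rule SUP_mono)
    fix n :: nat
    have "real n \<le> (b + real n) powr p"
    proof (cases "n = 0")
      case False
      then have "(b + real n) powr 1 \<le> (b + real n) powr p" using assms by (intro powr_mono) auto
      then show ?thesis using assms by simp
    qed simp
    moreover have "enn2real (min y (ennreal (b + real n))) = b + real n"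
      using top assms by (simp del: ennreal_plus)
    ultimately show "\<exists>m\<in>UNIV. (of_nat n :: ennreal) \<le> ennreal (enn2real (min y (ennreal (b + real m))) powr p)"
      by (intro bexI[of _ n]) (simp_all add: ennreal_leI ennreal_of_nat_eq_real_of_nat)
  qed
  then have "(SUP n. ennreal (enn2real (min y (ennreal (b + real n))) powr p)) = \<top>"
    unfolding ennreal_SUP_of_nat_eq_top top_unique .
  then show ?thesis using top by (simp only: ennreal_powr_def simp_thms if_True)
qed

text \<open>\<open>K\<close> and \<open>b\<close> do not depend on the truncation level, so monotone
  convergence removes the truncation, with \<open>B = b * k\<close>.\<close>

lemma maxf_integral_le_candidate:
  fixes p k :: real
  assumes p: "p > 1" and k: "0 < k" "k < 1"
    and f: "0 < integral\<^sup>L M \<phi>" and F: "integrable M (\<lambda>x. \<phi> x powr p)"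
    and K0 [measurable]: "K0 \<in> sets M" "measure M K0 = k"
  defines "f \<equiv> integral\<^sup>L M \<phi>" and "F \<equiv> integral\<^sup>L M (\<lambda>x. \<phi> x powr p)"
  shows "\<exists>B\<in>{0..f}. h_fun p f k B \<le> F \<and>
    (\<integral>\<^sup>+x\<in>K0. ennreal_powr (maxf x) p \<partial>M) \<le> ennreal (candidate p f F k B)"
proof -
  obtain K b where K: "K \<in> sets M" "measure M K = k"
    and b: "integral\<^sup>L M \<phi> \<le> b" "(LINT x:K|M. \<phi> x) = b * k" "{x \<in> space M. ennreal b < maxf x} \<subseteq> K"
    using ex_superlevel_set[OF k f] by blast
  have b0: "b > 0" using b f by simp
  note tr = maxf_truncated_le_candidate[OF p k f F K b0 b(2,3) _ K0]
  let ?u = "\<lambda>n x. ennreal (enn2real (min (maxf x) (ennreal (b + real n))) powr p) * indicator K0 x"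
  have "(\<integral>\<^sup>+x\<in>K0. ennreal_powr (maxf x) p \<partial>M) = (\<integral>\<^sup>+x. (SUP n. ?u n x) \<partial>M)"
    using p b0 by (intro nn_integral_cong) (auto simp: indicator_def ennreal_powr_eq_SUP[of p b])
  also have "\<dots> = (SUP n. \<integral>\<^sup>+x. ?u n x \<partial>M)"
  proof (rule nn_integral_monotone_convergence_SUP)
    show "incseq ?u"
      using p b0 by (intro incseq_SucI le_funI mult_right_mono ennreal_leI powr_mono2 enn2real_mono min.mono)
        (auto simp: min_less_iff_disj)
  qed measurable
  also have "\<dots> \<le> ennreal (candidate p f F k (b * k))"
    unfolding f_def F_def by (rule SUP_least, rule tr(2)) simp
  finally have "(\<integral>\<^sup>+x\<in>K0. ennreal_powr (maxf x) p \<partial>M) \<le> ennreal (candidate p f F k (b * k))" .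
  moreover have "h_fun p f k (b * k) \<le> F" unfolding f_def F_def by (rule tr(1)[OF order_refl])
  moreover have "b * k \<le> f"
  proof -
    have "(LINT x:K|M. \<phi> x) \<le> f"
      unfolding set_lebesgue_integral_def f_def
      using set_integrable_phi[OF K(1)] phi_nonneg
      by (intro integral_mono_AE phi_int AE_I2) (auto simp: indicator_def set_integrable_def)
    then show ?thesis using b by simp
  qed
  moreover have "0 \<le> b * k" using b0 k by simp
  ultimately show ?thesis by (intro bexI[of _ "b * k"]) auto
qed

end

end

section \<open>Extremal functions\<close>

lemma ennreal_powr_ge:
  assumes "ennreal y \<le> u" "0 \<le> y" "p \<ge> 0"
  shows "ennreal (y powr p) \<le> ennreal_powr u p"
proof (cases u)
  case (real r)
  then show ?thesis using assms by (auto simp: ennreal_powr_def ennreal_le_iff intro!: ennreal_leI powr_mono2)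
qed (simp add: ennreal_powr_def)

text \<open>For a decreasing sequence \<open>U\<close> the value is \<open>w m\<close> on the layer
  \<open>U m - U (Suc m)\<close>. Points in all the \<open>U m\<close> get 0, and points outside
  \<open>U 0\<close> get \<open>w 0\<close>, so only the values on \<open>U 0\<close> are
  meaningful.\<close>

definition step_fun :: "(nat \<Rightarrow> 'a set) \<Rightarrow> (nat \<Rightarrow> real) \<Rightarrow> 'a \<Rightarrow> real" where
  "step_fun U w x = (if \<forall>m. x \<in> U m then 0 else w (LEAST m. x \<notin> U (Suc m)))"

lemma step_fun_layer:
  assumes "decseq U" "x \<in> U n" "\<not> (\<forall>m. x \<in> U m)"
  obtains l where "n \<le> l" "\<And>w. step_fun U w x = w l" "\<And>m. x \<in> U m - U (Suc m) \<longleftrightarrow> m = l"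
proof -
  have dec: "i \<le> j \<Longrightarrow> x \<in> U j \<Longrightarrow> x \<in> U i" for i j using decseqD[OF assms(1)] by blast
  define l where "l = (LEAST m. x \<notin> U (Suc m))"
  obtain m where m: "x \<notin> U m" using assms by blast
  then have "m \<noteq> 0" using dec[OF le0 assms(2)] by (cases m) auto
  then have "\<exists>m. x \<notin> U (Suc m)" using m by (cases m) auto
  then have l: "x \<notin> U (Suc l)" unfolding l_def by (rule LeastI_ex)
  have lt: "x \<in> U (Suc m)" if "m < l" for m using that not_less_Least unfolding l_def by blast
  have xl: "x \<in> U l" using lt[of "l - 1"] dec[OF le0 assms(2)] by (cases l) auto
  have "x \<in> U m - U (Suc m) \<longleftrightarrow> m = l" for m
  proof
    assume m: "x \<in> U m - U (Suc m)"
    then have "\<not> m < l" using lt by blast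
    moreover have "\<not> l < m" using m l dec[of "Suc l" m] by auto
    ultimately show "m = l" by simp
  qed (use l xl in auto)
  moreover have "n \<le> l" using l dec[of "Suc l" n] assms(2) by (meson not_less_eq_eq)
  moreover have "step_fun U w x = w l" for w using m by (auto simp: step_fun_def l_def)
  ultimately show thesis using that by blast
qed

lemma step_fun_eq_suminf:
  assumes "decseq U" "x \<in> U n"
  shows "ennreal (step_fun U w x)
    = (\<Sum>j. ennreal (w (n + j)) * indicator (U (n + j) - U (Suc (n + j))) x)"
proof (cases "\<forall>m. x \<in> U m")
  case True
  then show ?thesis by (simp add: step_fun_def)
next
  case False
  obtain l where l: "n \<le> l" "\<And>w. step_fun U w x = w l" "\<And>m. x \<in> U m - U (Suc m) \<longleftrightarrow> m = l"
    using step_fun_layer[OF assms False] by blast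
  have "(\<Sum>j. ennreal (w (n + j)) * indicator (U (n + j) - U (Suc (n + j))) x)
      = (\<Sum>j\<in>{l - n}. ennreal (w (n + j)) * indicator (U (n + j) - U (Suc (n + j))) x)"
  proof (intro suminf_finite)
    fix j assume "j \<notin> {l - n}"
    then have "n + j \<noteq> l" using l(1) by auto
    then show "ennreal (w (n + j)) * indicator (U (n + j) - U (Suc (n + j))) x = 0"
      using l(3)[of "n + j"] by simp
  qed simp
  also have "\<dots> = ennreal (w l)" using l(1) l(3)[of l] by (simp add: indicator_def)
  finally show ?thesis by (simp add: l(2))
qed

lemma step_fun_measurable:
  assumes [measurable]: "\<And>m. U m \<in> sets M"
  shows "step_fun U w \<in> borel_measurable M"
proof -
  have [measurable]: "(\<lambda>x. LEAST m. x \<notin> U (Suc m)) \<in> measurable M (count_space UNIV)" by measurable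
  show ?thesis unfolding step_fun_def[abs_def] by measurable
qed

text \<open>Layer \<open>n + j\<close> meets \<open>S\<close> in measure
  \<open>a * (1 - a) ^ j * \<sigma>\<close>, so the integral is a geometric series of ratio
  \<open>g * (1 - a)\<close>. The case \<open>j = 0\<close> of \<open>meas\<close> says that
  \<open>\<sigma>\<close> is the measure of \<open>S\<close>; general \<open>S\<close> covers both
  \<open>K\<close> and a single tree set.\<close>

lemma (in finite_measure) step_fun_integral:
  assumes [measurable]: "\<And>m. U m \<in> sets M" "S \<in> sets M"
    and dec: "decseq U" and S: "S \<subseteq> U n"
    and meas: "\<And>j. measure M (S \<inter> U (n + j)) = (1 - a) ^ j * \<sigma>"
    and a: "0 < a" "a < 1" "0 \<le> c" "0 \<le> g" "g * (1 - a) < 1" and \<sigma>: "0 \<le> \<sigma>"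
  shows "(\<integral>\<^sup>+x\<in>S. ennreal (step_fun U (\<lambda>m. c * g ^ m) x) \<partial>M)
      = ennreal (c * g ^ n * (a / (1 - g * (1 - a))) * \<sigma>)"
proof -
  define w where "w = (\<lambda>m. c * g ^ m)"
  have w0: "0 \<le> w m" for m using a by (simp add: w_def)
  have "(\<integral>\<^sup>+x\<in>S. ennreal (step_fun U w x) \<partial>M)
    = (\<integral>\<^sup>+x. (\<Sum>j. ennreal (w (n + j)) * indicator (S \<inter> (U (n + j) - U (Suc (n + j)))) x) \<partial>M)"
  proof (rule nn_integral_cong)
    fix x show "ennreal (step_fun U w x) * indicator S x
      = (\<Sum>j. ennreal (w (n + j)) * indicator (S \<inter> (U (n + j) - U (Suc (n + j)))) x)"
    proof (cases "x \<in> S")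
      case True
      then have "x \<in> U n" using S by blast
      from step_fun_eq_suminf[OF dec this, of w] show ?thesis using True by (simp add: indicator_inter_arith)
    qed simp
  qed
  also have "\<dots> = (\<Sum>j. \<integral>\<^sup>+x. ennreal (w (n + j)) * indicator (S \<inter> (U (n + j) - U (Suc (n + j)))) x \<partial>M)"
    by (rule nn_integral_suminf) measurable
  also have "\<dots> = (\<Sum>j. ennreal (c * g ^ n * a * \<sigma> * (g * (1 - a)) ^ j))"
  proof (rule suminf_cong)
    fix j
    have "measure M (S \<inter> (U (n + j) - U (Suc (n + j))))
        = measure M (S \<inter> U (n + j)) - measure M (S \<inter> U (Suc (n + j)))"
    proof -
      have "U (Suc (n + j)) \<subseteq> U (n + j)" using dec by (simp add: decseq_Suc_iff)
      then have "S \<inter> (U (n + j) - U (Suc (n + j))) = S \<inter> U (n + j) - S \<inter> U (Suc (n + j))"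
        "S \<inter> U (Suc (n + j)) \<subseteq> S \<inter> U (n + j)" by auto
      then show ?thesis by (simp add: finite_measure_Diff)
    qed
    also have "\<dots> = a * (1 - a) ^ j * \<sigma>"
      using meas[of j] meas[of "Suc j"] by (simp add: algebra_simps)
    finally have m: "emeasure M (S \<inter> (U (n + j) - U (Suc (n + j)))) = ennreal (a * (1 - a) ^ j * \<sigma>)"
      by (simp add: emeasure_eq_measure)
    have "(\<integral>\<^sup>+x. ennreal (w (n + j)) * indicator (S \<inter> (U (n + j) - U (Suc (n + j)))) x \<partial>M)
      = ennreal (w (n + j)) * ennreal (a * (1 - a) ^ j * \<sigma>)"
      by (subst nn_integral_cmult_indicator) (auto simp: m)
    also have "\<dots> = ennreal (w (n + j) * (a * (1 - a) ^ j * \<sigma>))"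
      using w0 a \<sigma> by (intro ennreal_mult[symmetric]) auto
    also have "w (n + j) * (a * (1 - a) ^ j * \<sigma>) = c * g ^ n * a * \<sigma> * (g * (1 - a)) ^ j"
      by (simp add: w_def power_add power_mult_distrib mult_ac)
    finally show "(\<integral>\<^sup>+x. ennreal (w (n + j)) * indicator (S \<inter> (U (n + j) - U (Suc (n + j)))) x \<partial>M)
      = ennreal (c * g ^ n * a * \<sigma> * (g * (1 - a)) ^ j)" .
  qed
  also have "\<dots> = ennreal (c * g ^ n * a * \<sigma> * (1 / (1 - g * (1 - a))))"
  proof (rule suminf_ennreal_eq)
    show "(\<lambda>j. c * g ^ n * a * \<sigma> * (g * (1 - a)) ^ j) sums (c * g ^ n * a * \<sigma> * (1 / (1 - g * (1 - a))))"
      using a by (intro sums_mult geometric_sums) (simp add: abs_mult)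
  qed (use a \<sigma> in auto)
  finally show ?thesis unfolding w_def by (simp add: mult_ac)
qed

context maximal_tree
begin

section \<open>Nested families of tree sets and the extremal function\<close>

lemma measure_Union_Int:
  assumes S: "\<S> \<subseteq> T" "disjoint \<S>" and V [measurable]: "V \<in> sets M"
    and c: "0 \<le> c" "\<And>J. J \<in> \<S> \<Longrightarrow> measure M (J \<inter> V) = c * measure M J"
  shows "measure M (\<Union>\<S> \<inter> V) = c * measure M (\<Union>\<S>)"
proof -
  have cS: "countable \<S>" using countable_subset[OF S(1) countable_T] .
  have mS: "I \<in> sets M" if "I \<in> \<S>" for I using that S T_sets by blast
  have disj: "disjoint_family_on (\<lambda>I. I) \<S>" "disjoint_family_on (\<lambda>I. I \<inter> V) \<S>"
    using S(2) by (auto simp: disjoint_family_on_def dest: disjointD)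
  have "\<Union>\<S> \<inter> V = (\<Union>I\<in>\<S>. I \<inter> V)" by auto
  then have "emeasure M (\<Union>\<S> \<inter> V) = emeasure M (\<Union>I\<in>\<S>. I \<inter> V)" by (simp only:)
  also have "\<dots> = (\<integral>\<^sup>+I. emeasure M (I \<inter> V) \<partial>count_space \<S>)"
    by (rule emeasure_UN_countable[OF _ cS disj(2)]) (use mS in auto)
  also have "\<dots> = (\<integral>\<^sup>+I. ennreal c * emeasure M I \<partial>count_space \<S>)"
    using c by (intro nn_integral_cong) (simp add: emeasure_eq_measure ennreal_mult)
  also have "\<dots> = ennreal c * (\<integral>\<^sup>+I. emeasure M I \<partial>count_space \<S>)"
    by (rule nn_integral_cmult) simp
  also have "(\<integral>\<^sup>+I. emeasure M I \<partial>count_space \<S>) = emeasure M (\<Union>\<S>)"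
    using emeasure_UN_countable[OF mS cS disj(1)] by simp
  finally show ?thesis using c by (simp add: emeasure_eq_measure flip: ennreal_mult)
qed

text \<open>Iterates \<open>ex_subfamily_measure\<close> with proportion \<open>1 - a\<close>. The
  proportion holds inside each single member, not only for the unions, because averages over
  individual tree sets are needed later.\<close>

lemma ex_nested_families:
  assumes a: "0 < a" "a < 1" and D: "\<D> \<subseteq> T" "disjoint \<D>"
  shows "\<exists>L. L 0 = \<D> \<and> (\<forall>m. L m \<subseteq> T) \<and> decseq (\<lambda>m. \<Union>(L m)) \<and>
    (\<forall>m j. \<forall>I\<in>L m. measure M (I \<inter> \<Union>(L (m + j))) = (1 - a) ^ j * measure M I)"
proof -
  have "\<forall>I\<in>T. \<exists>\<S>. \<S> \<subseteq> T \<and> disjoint \<S> \<and> (\<forall>J\<in>\<S>. J \<subseteq> I) \<and> measure M (\<Union>\<S>) = (1 - a) * measure M I"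
  proof
    fix I assume "I \<in> T"
    moreover have "(1 - a) * measure M I \<le> 1 * measure M I" using a by (intro mult_right_mono) auto
    ultimately show "\<exists>\<S>. \<S> \<subseteq> T \<and> disjoint \<S> \<and> (\<forall>J\<in>\<S>. J \<subseteq> I) \<and> measure M (\<Union>\<S>) = (1 - a) * measure M I"
      using ex_subfamily_measure[of I "(1 - a) * measure M I"] a by auto
  qed
  then obtain d where d: "\<And>I. I \<in> T \<Longrightarrow> d I \<subseteq> T" "\<And>I. I \<in> T \<Longrightarrow> disjoint (d I)"
    "\<And>I J. I \<in> T \<Longrightarrow> J \<in> d I \<Longrightarrow> J \<subseteq> I"
    "\<And>I. I \<in> T \<Longrightarrow> measure M (\<Union>(d I)) = (1 - a) * measure M I"
    by (metis (no_types, lifting))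
  define L where "L = rec_nat \<D> (\<lambda>_ \<X>. \<Union>I\<in>\<X>. d I)"
  have L0: "L 0 = \<D>" and LS: "L (Suc m) = (\<Union>I\<in>L m. d I)" for m by (simp_all add: L_def)
  have LT: "L m \<subseteq> T" for m
  proof (induction m)
    case (Suc m)
    then show ?case unfolding LS using d(1) by blast
  qed (simp add: L0 D)
  have Ld: "disjoint (L m)" for m
  proof (induction m)
    case (Suc m)
    show ?case
    proof (rule disjointI)
      fix J J' assume J: "J \<in> L (Suc m)" "J' \<in> L (Suc m)" "J \<noteq> J'"
      then obtain I I' where I: "I \<in> L m" "J \<in> d I" "I' \<in> L m" "J' \<in> d I'" by (auto simp: LS)
      then have T: "I \<in> T" "I' \<in> T" using LT by auto
      show "J \<inter> J' = {}"
      proof (cases "I = I'")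
        case True
        then show ?thesis using d(2)[OF T(1)] I J(3) by (auto dest: disjointD)
      next
        case False
        then have "I \<inter> I' = {}" using Suc I by (auto dest: disjointD)
        then show ?thesis using d(3)[OF T(1) I(2)] d(3)[OF T(2) I(4)] by blast
      qed
    qed
  qed (simp add: L0 D)
  have step: "I \<inter> \<Union>(L (Suc m)) = \<Union>(d I)" if I: "I \<in> L m" for I m
  proof
    have IT: "I \<in> T" using I LT by blast
    show "\<Union>(d I) \<subseteq> I \<inter> \<Union>(L (Suc m))" using d(3)[OF IT] I by (auto simp: LS)
    show "I \<inter> \<Union>(L (Suc m)) \<subseteq> \<Union>(d I)"
    proof
      fix x assume x: "x \<in> I \<inter> \<Union>(L (Suc m))"
      then obtain I' J where J: "I' \<in> L m" "J \<in> d I'" "x \<in> J" by (auto simp: LS)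
      then have "x \<in> I'" using d(3)[of I' J] LT by blast
      then have "I' = I" using disjointD[OF Ld[of m] J(1) I] x by blast
      then show "x \<in> \<Union>(d I)" using J by blast
    qed
  qed
  have dec: "decseq (\<lambda>m. \<Union>(L m))"
  proof (rule decseq_SucI)
    fix m show "\<Union>(L (Suc m)) \<subseteq> \<Union>(L m)"
    proof
      fix x assume "x \<in> \<Union>(L (Suc m))"
      then obtain I J where "I \<in> L m" "J \<in> d I" "x \<in> J" by (auto simp: LS)
      then show "x \<in> \<Union>(L m)" using d(3)[of I J] LT by blast
    qed
  qed
  have "measure M (I \<inter> \<Union>(L (m + j))) = (1 - a) ^ j * measure M I" if "I \<in> L m" for I m j
    using that
  proof (induction j arbitrary: m I)
    case 0
    then have "I \<inter> \<Union>(L m) = I" by blast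
    then show ?case by simp
  next
    case (Suc j)
    have IT: "I \<in> T" using Suc.prems LT by blast
    \<comment> \<open>Generation \<open>m + Suc j\<close> seen from \<open>I\<close> is generation
      \<open>Suc m + j\<close> seen from the members of \<open>d I\<close>, hence an induction with
      \<open>m\<close> arbitrary.\<close>
    have "\<Union>(L (m + Suc j)) \<subseteq> \<Union>(L (Suc m))" using decseqD[OF dec, of "Suc m" "m + Suc j"] by simp
    then have "I \<inter> \<Union>(L (m + Suc j)) = \<Union>(d I) \<inter> \<Union>(L (Suc m + j))"
      unfolding step[OF Suc.prems, symmetric] by auto
    also have "measure M \<dots> = (1 - a) ^ j * measure M (\<Union>(d I))"
    proof (rule measure_Union_Int)
      fix J assume "J \<in> d I"
      then have "J \<in> L (Suc m)" using Suc.prems by (auto simp: LS)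
      then show "measure M (J \<inter> \<Union>(L (Suc m + j))) = (1 - a) ^ j * measure M J" by (rule Suc.IH)
    qed (use a d IT Union_measurable[OF LT] in auto)
    finally show ?case using d(4)[OF IT] by (simp add: mult_ac)
  qed
  then show ?thesis using L0 LT dec by (intro exI[of _ L]) blast
qed

text \<open>With \<open>\<phi> = c \<gamma> ^ m\<close> on the \<open>m\<close>-th layer of \<open>K\<close>, the mean of \<open>\<phi>\<close> over each tree set of the
  \<open>m\<close>-th family is \<open>r c \<gamma> ^ m\<close>, whence \<open>tree_maximal M T \<phi> \<ge> r \<phi>\<close> on \<open>K\<close>.\<close>

lemma Bellman_ge_extremal:
  fixes p f F k B A q x :: real
  assumes p: "p > 1" and k: "0 < k" "k < 1" and B: "0 < B" "B \<le> f"
    and h: "h_fun p f k B \<le> F"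
  defines "A \<equiv> F - (f - B) powr p / (1 - k) powr (p - 1)"
  defines "q \<equiv> B powr p / (k powr (p - 1) * A)"
  assumes x: "0 \<le> x" "x < omega_fun p q"
  shows "ennreal (A * x powr p) \<le> Bellman M T p f F k"
proof -
  have AB: "B powr p / k powr (p - 1) \<le> A" using h by (simp add: h_fun_def A_def)
  have pos: "0 < B powr p / k powr (p - 1)" using B k by simp
  then have A0: "0 < A" using AB by linarith
  have q_eq: "q = B powr p / k powr (p - 1) / A" by (simp add: q_def)
  have q: "0 < q" "q \<le> 1" unfolding q_eq using AB pos A0
    by (auto simp only: zero_less_divide_iff pos_divide_le_eq mult_1)
  obtain a r where a: "0 < a" "a < 1" and r: "1 \<le> r" "x \<le> r" and Q: "Q_fun p a r = q"
    using Q_fun_solve[OF p q x(2)] by blast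
  \<comment> \<open>The choice gives mean \<open>c * r = B / k\<close> on \<open>K\<close>, hence
    integral \<open>B\<close> there, and the constant \<open>d\<close> carries the remaining
    \<open>f - B\<close> off \<open>K\<close>.\<close>
  define \<gamma> c d where "\<gamma> = (1 - a / r) / (1 - a)" and "c = B / (k * r)" and "d = (f - B) / (1 - k)"
  have ar: "a / r < 1" "0 < a / r" using a r by (auto simp: divide_less_eq)
  have g: "0 < \<gamma>" "\<gamma> * (1 - a) = 1 - a / r" using a ar by (auto simp: \<gamma>_def)
  \<comment> \<open>The equation \<open>Q_fun p a r = q\<close> evaluates the geometric series of
    the \<open>p\<close>-th powers and makes their integral over \<open>K\<close> exactly
    \<open>A\<close>.\<close>
  have "q * a = r powr p * (1 - \<gamma> powr p * (1 - a))"
    unfolding Q[symmetric] Q_fun_def \<gamma>_def using a by simp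
  then have gp: "1 - \<gamma> powr p * (1 - a) = q * a / r powr p" using r by simp
  have gp1: "\<gamma> powr p * (1 - a) < 1"
  proof -
    have "0 < q * a / r powr p" using q a r by simp
    then show ?thesis using gp by linarith
  qed
  have c: "0 < c" using B k r by (simp add: c_def)
  have d: "0 \<le> d" using B k by (simp add: d_def)
  obtain \<D> where D: "\<D> \<subseteq> T" "disjoint \<D>" "measure M (\<Union>\<D>) = k"
    using ex_subfamily_measure[OF space_in_T, of k] k prob_space by auto
  obtain L where L: "L 0 = \<D>" "\<And>m. L m \<subseteq> T" "decseq (\<lambda>m. \<Union>(L m))"
    "\<And>m j I. I \<in> L m \<Longrightarrow> measure M (I \<inter> \<Union>(L (m + j))) = (1 - a) ^ j * measure M I"
    using ex_nested_families[OF a D(1,2)] by blast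
  define U where "U m = \<Union>(L m)" for m
  have U [measurable]: "U m \<in> sets M" for m unfolding U_def by (rule Union_measurable[OF L(2)])
  have dec: "decseq U" using L(3) by (simp add: U_def[abs_def])
  define K where "K = U 0"
  have K [measurable]: "K \<in> sets M" unfolding K_def by (rule U)
  have Kk: "measure M K = k" by (simp add: K_def U_def L(1) D(3))
  have UK: "measure M (K \<inter> U (0 + j)) = (1 - a) ^ j * k" for j
    unfolding K_def U_def[of 0] using a D L(1) L(4)[of _ 0 j] U[of j]
    by (subst measure_Union_Int[of _ _ "(1 - a) ^ j"]) (auto simp: U_def)
  define \<phi> where "\<phi> y = (if y \<in> K then step_fun U (\<lambda>m. c * \<gamma> ^ m) y else d)" for y
  have [measurable]: "step_fun U (\<lambda>m. c * \<gamma> ^ m) \<in> borel_measurable M"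
    by (rule step_fun_measurable) simp
  have phi_meas [measurable]: "\<phi> \<in> borel_measurable M" unfolding \<phi>_def by measurable
  have phi0: "0 \<le> \<phi> y" for y using c d g by (auto simp: \<phi>_def step_fun_def)
  have powr_step: "step_fun U (\<lambda>m. c * \<gamma> ^ m) y powr p = step_fun U (\<lambda>m. c powr p * (\<gamma> powr p) ^ m) y" for y
  proof -
    have "(c * \<gamma> ^ m) powr p = c powr p * (\<gamma> powr p) ^ m" for m
      using c g by (simp add: powr_mult powr_powr mult.commute flip: powr_realpow)
    then show ?thesis by (simp add: step_fun_def)
  qed
  have split: "(\<integral>\<^sup>+y. ennreal (G (\<phi> y)) \<partial>M)
      = (\<integral>\<^sup>+y\<in>K. ennreal (G (step_fun U (\<lambda>m. c * \<gamma> ^ m) y)) \<partial>M) + ennreal (G d * (1 - k))"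
    if [measurable]: "G \<in> borel_measurable borel" and "0 \<le> G d" for G :: "real \<Rightarrow> real"
  proof -
    have "(\<integral>\<^sup>+y. ennreal (G (\<phi> y)) \<partial>M) = (\<integral>\<^sup>+y. ennreal (G (step_fun U (\<lambda>m. c * \<gamma> ^ m) y)) * indicator K y
        + ennreal (G d) * indicator (space M - K) y \<partial>M)"
      by (intro nn_integral_cong) (auto simp: \<phi>_def indicator_def)
    also have "\<dots> = (\<integral>\<^sup>+y\<in>K. ennreal (G (step_fun U (\<lambda>m. c * \<gamma> ^ m) y)) \<partial>M)
        + (\<integral>\<^sup>+y. ennreal (G d) * indicator (space M - K) y \<partial>M)"
      by (rule nn_integral_add) measurable
    also have "(\<integral>\<^sup>+y. ennreal (G d) * indicator (space M - K) y \<partial>M) = ennreal (G d * (1 - k))"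
      using that k Kk prob_compl[OF K]
      by (subst nn_integral_cmult_indicator) (auto simp: emeasure_eq_measure ennreal_mult)
    finally show ?thesis .
  qed
  have intK: "(\<integral>\<^sup>+y\<in>K. ennreal (step_fun U (\<lambda>m. c * \<gamma> ^ m) y) \<partial>M) = ennreal B"
  proof -
    have "(\<integral>\<^sup>+y\<in>K. ennreal (step_fun U (\<lambda>m. c * \<gamma> ^ m) y) \<partial>M)
        = ennreal (c * \<gamma> ^ 0 * (a / (1 - \<gamma> * (1 - a))) * k)"
      by (rule step_fun_integral[OF U K dec]) (use UK a c g ar k in \<open>auto simp: K_def\<close>)
    also have "c * \<gamma> ^ 0 * (a / (1 - \<gamma> * (1 - a))) * k = B"
      using a r k by (simp add: g c_def)
    finally show ?thesis .
  qed
  have kp: "k * (B / k) powr p = B powr p / k powr (p - 1)"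
    using B k powr_diff[of k p 1] by (simp add: powr_divide)
  have intKp: "(\<integral>\<^sup>+y\<in>K. ennreal (step_fun U (\<lambda>m. c * \<gamma> ^ m) y powr p) \<partial>M) = ennreal A"
  proof -
    have "(\<integral>\<^sup>+y\<in>K. ennreal (step_fun U (\<lambda>m. c powr p * (\<gamma> powr p) ^ m) y) \<partial>M)
        = ennreal (c powr p * (\<gamma> powr p) ^ 0 * (a / (1 - \<gamma> powr p * (1 - a))) * k)"
      by (rule step_fun_integral[OF U K dec]) (use UK a c gp1 k in \<open>auto simp: K_def\<close>)
    also have "c powr p * (\<gamma> powr p) ^ 0 * (a / (1 - \<gamma> powr p * (1 - a))) * k
        = (c powr p * r powr p) * k / q"
      using a by (simp add: gp)
    also have "c powr p * r powr p = (B / k) powr p"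
      using c r by (simp add: c_def flip: powr_mult)
    also have "(B / k) powr p * k / q = A"
    proof -
      have "(B / k) powr p * k = q * A" using kp A0 by (simp add: q_eq mult.commute)
      then show ?thesis using q by simp
    qed
    finally show ?thesis unfolding powr_step .
  qed
  have int_phi: "(\<integral>\<^sup>+y. ennreal (\<phi> y) \<partial>M) = ennreal f"
    using split[of "\<lambda>t. t"] d intK B k by (simp add: d_def flip: ennreal_plus)
  have int_phip: "(\<integral>\<^sup>+y. ennreal (\<phi> y powr p) \<partial>M) = ennreal F"
  proof -
    have "d powr p * (1 - k) = (f - B) powr p / (1 - k) powr (p - 1)"
      using B k powr_diff[of "1 - k" p 1] by (simp add: d_def powr_divide)
    then have "A + d powr p * (1 - k) = F" by (simp add: A_def)
    then show ?thesis using split[of "\<lambda>t. t powr p"] intKp A0 k by (simp flip: ennreal_plus)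
  qed
  have max_ge: "ennreal (r * \<phi> y) \<le> tree_maximal M T \<phi> y" if y: "y \<in> K" for y
  proof (cases "\<forall>m. y \<in> U m")
    case True
    then show ?thesis using y by (simp add: \<phi>_def step_fun_def)
  next
    case False
    have "y \<in> U 0" using y by (simp add: K_def)
    \<comment> \<open>The layer index of \<open>y\<close> selects a member of the
      \<open>l\<close>-th family containing \<open>y\<close>; its average is
      \<open>r * c * \<gamma> ^ l\<close>, that is \<open>r * \<phi> y\<close>.\<close>
    then obtain l where l: "\<And>w. step_fun U w y = w l" "y \<in> U l - U (Suc l)"
      using step_fun_layer[OF dec _ False] by metis
    then obtain I where I: "I \<in> L l" "y \<in> I" by (auto simp: U_def)
    have IT: "I \<in> T" using I L by blast
    have IU: "I \<subseteq> U l" using I by (auto simp: U_def)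
    then have IK: "I \<subseteq> K" using decseqD[OF dec, of 0 l] by (auto simp: K_def)
    have "(\<integral>\<^sup>+z\<in>I. ennreal \<bar>\<phi> z\<bar> \<partial>M) = (\<integral>\<^sup>+z\<in>I. ennreal (step_fun U (\<lambda>m. c * \<gamma> ^ m) z) \<partial>M)"
      using phi0 IK by (intro nn_integral_cong) (auto simp: indicator_def \<phi>_def)
    also have "\<dots> = ennreal (c * \<gamma> ^ l * (a / (1 - \<gamma> * (1 - a))) * measure M I)"
      by (rule step_fun_integral[OF U T_measurable[OF IT] dec IU])
        (use L(4)[OF I(1)] a c g ar in \<open>auto simp: U_def\<close>)
    also have "c * \<gamma> ^ l * (a / (1 - \<gamma> * (1 - a))) * measure M I = (r * \<phi> y) * measure M I"
      using a r y by (simp add: g \<phi>_def l(1))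
    finally have "(\<integral>\<^sup>+z\<in>I. ennreal \<bar>\<phi> z\<bar> \<partial>M) / emeasure M I = ennreal (r * \<phi> y)"
      using T_pos[OF IT] r phi0[of y] by (simp add: emeasure_eq_measure divide_ennreal)
    then show ?thesis unfolding tree_maximal_def using IT I(2)
      by (intro SUP_upper2[of I]) auto
  qed
  have "ennreal (A * x powr p) \<le> ennreal (r powr p * A)"
    using A0 x r p by (intro ennreal_leI) (simp add: mult.commute powr_mono2)
  also have "\<dots> = ennreal (r powr p) * (\<integral>\<^sup>+y\<in>K. ennreal (step_fun U (\<lambda>m. c * \<gamma> ^ m) y powr p) \<partial>M)"
    unfolding intKp using A0 by (intro ennreal_mult) auto
  also have "\<dots> = (\<integral>\<^sup>+y. ennreal (r powr p) * (ennreal (step_fun U (\<lambda>m. c * \<gamma> ^ m) y powr p) * indicator K y) \<partial>M)"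
    by (rule nn_integral_cmult[symmetric]) measurable
  also have "\<dots> \<le> (\<integral>\<^sup>+y\<in>K. ennreal_powr (tree_maximal M T \<phi> y) p \<partial>M)"
  proof (rule nn_integral_mono)
    fix y
    show "ennreal (r powr p) * (ennreal (step_fun U (\<lambda>m. c * \<gamma> ^ m) y powr p) * indicator K y)
      \<le> ennreal_powr (tree_maximal M T \<phi> y) p * indicator K y"
    proof (cases "y \<in> K")
      case True
      have "ennreal ((r * \<phi> y) powr p) \<le> ennreal_powr (tree_maximal M T \<phi> y) p"
        using max_ge[OF True] r phi0[of y] p by (intro ennreal_powr_ge) auto
      moreover have "ennreal ((r * \<phi> y) powr p)
          = ennreal (r powr p) * ennreal (step_fun U (\<lambda>m. c * \<gamma> ^ m) y powr p)"
        using r phi0[of y] True by (simp add: powr_mult ennreal_mult \<phi>_def)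
      ultimately show ?thesis using True by simp
    qed simp
  qed
  also have "\<dots> \<le> Bellman M T p f F k"
    unfolding Bellman_def
    by (rule Sup_upper) (use phi_meas phi0 int_phi int_phip K Kk in blast)
  finally show ?thesis .
qed

end

section \<open>The lower bound\<close>

context maximal_tree
begin

text \<open>The extremal construction requires \<open>B > 0\<close>, so \<open>B = 0\<close> is
  reached by a small positive \<open>B\<close>: this only enlarges \<open>A\<close>, and its
  \<open>q\<close> is so small that \<open>x\<close> stays below
  \<open>omega_fun p q\<close>.\<close>

lemma Bellman_ge_at_zero:
  fixes p f F k x :: real
  assumes p: "p > 1" and k: "0 < k" "k < 1" and f: "0 < f"
  defines "A \<equiv> F - f powr p / (1 - k) powr (p - 1)"
  assumes A: "0 < A" and x: "0 \<le> x" "x < omega_fun p 0"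
  shows "ennreal (A * x powr p) \<le> Bellman M T p f F k"
proof -
  have om: "omega_fun p 0 = p / (p - 1)"
    using H_fun_strict_antimono[of p "omega_fun p 0" "p / (p - 1)"] omega_fun[of p 0] p H_fun_end[OF p]
    by (auto simp: order_less_le)
  define y where "y = max x 1"
  have y: "1 \<le> y" "x \<le> y" "y < omega_fun p 0" using x p by (auto simp: y_def om)
  have Hy: "0 < H_fun p y" using H_fun_gt_if_less_omega_fun[of p 0 y] p y by simp
  have Hy1: "H_fun p y \<le> 1"
    using H_fun_strict_antimono[of p 1 y] p y H_fun_one[of p] by (cases "y = 1") auto
  \<comment> \<open>The second entry makes \<open>B powr p / k powr (p - 1)\<close> at most
    \<open>A * H_fun p y / 2\<close>, hence \<open>q \<le> H_fun p y / 2\<close>; the minimum keeps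
    \<open>B \<le> f\<close>.\<close>
  define B where "B = min f ((k powr (p - 1) * (A * H_fun p y / 2)) powr (1 / p))"
  have B: "0 < B" "B \<le> f" using f k A Hy by (auto simp: B_def)
  have "B powr p \<le> ((k powr (p - 1) * (A * H_fun p y / 2)) powr (1 / p)) powr p"
    using B p by (intro powr_mono2) (auto simp: B_def)
  also have "\<dots> = k powr (p - 1) * (A * H_fun p y / 2)"
    using k A Hy p by (simp add: powr_powr)
  finally have Bp: "B powr p / k powr (p - 1) \<le> A * (H_fun p y / 2)"
    using k by (simp add: pos_divide_le_eq mult.commute)
  define A' where "A' = F - (f - B) powr p / (1 - k) powr (p - 1)"
  have "(f - B) powr p \<le> f powr p" using B p by (intro powr_mono2) auto
  then have AA': "A \<le> A'" unfolding A_def A'_def by (simp add: divide_right_mono)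
  have le: "A * (H_fun p y / 2) \<le> A' * (H_fun p y / 2)" using AA' Hy by (intro mult_right_mono) auto
  have le1: "A' * (H_fun p y / 2) \<le> A' * 1" using AA' A Hy1 by (intro mult_left_mono) auto
  have "B powr p / k powr (p - 1) \<le> A'" using Bp le le1 by linarith
  then have h: "h_fun p f k B \<le> F" by (simp add: h_fun_def A'_def)
  define q where "q = B powr p / (k powr (p - 1) * A')"
  have "q = B powr p / k powr (p - 1) / A'" by (simp add: q_def)
  also have "\<dots> \<le> A' * (H_fun p y / 2) / A'"
    using Bp le AA' A by (intro divide_right_mono) linarith+
  also have "\<dots> = H_fun p y / 2" using AA' A by simp
  finally have q: "q < H_fun p y" "q \<le> 1" using Hy Hy1 by linarith+
  have q0: "0 \<le> q" using AA' A by (simp add: q_def)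
  have "x < omega_fun p q"
  proof -
    have "y \<noteq> omega_fun p q" using omega_fun(2)[OF p q0 q(2)] q by auto
    moreover have "y \<le> omega_fun p q" using le_omega_fun[OF p q0 q(2)] q by simp
    ultimately show ?thesis using y by simp
  qed
  then have "ennreal (A' * x powr p) \<le> Bellman M T p f F k"
    unfolding A'_def q_def using x by (intro Bellman_ge_extremal p k B h)
  moreover have "ennreal (A * x powr p) \<le> ennreal (A' * x powr p)"
    using AA' by (intro ennreal_leI mult_right_mono) auto
  ultimately show ?thesis by (rule order_trans[rotated])
qed

text \<open>The constructions yield \<open>A * x powr p\<close> for every nonnegative
  \<open>x\<close> strictly below \<open>omega_fun p q\<close>; letting \<open>x\<close> tend to it
  gives the candidate value.\<close>

lemma candidate_le_Bellman:
  fixes p f F k B :: real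
  assumes p: "p > 1" and k: "0 < k" "k < 1" and f: "0 < f"
    and B: "0 \<le> B" "B \<le> f" and h: "h_fun p f k B \<le> F"
  shows "ennreal (candidate p f F k B) \<le> Bellman M T p f F k"
proof -
  define A where "A = F - (f - B) powr p / (1 - k) powr (p - 1)"
  define q where "q = B powr p / (k powr (p - 1) * A)"
  have cand: "candidate p f F k B = (if A = 0 then 0 else A * omega_fun p q powr p)"
    by (simp add: candidate_def Let_def A_def q_def)
  have AB: "B powr p / k powr (p - 1) \<le> A" using h by (simp add: h_fun_def A_def)
  then have "0 \<le> A" by (rule order_trans[rotated]) simp
  show ?thesis
  proof (cases "A = 0")
    case False
    then have A: "0 < A" using \<open>0 \<le> A\<close> by simp
    have "q = B powr p / k powr (p - 1) / A" by (simp add: q_def)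
    also have "\<dots> \<le> 1" using AB A by (simp only: pos_divide_le_eq mult_1)
    finally have q: "0 \<le> q" "q \<le> 1" using A by (auto simp: q_def)
    define w where "w = omega_fun p q"
    have w: "1 \<le> w" using omega_fun(1)[OF p q] by (simp add: w_def)
    have below: "ennreal (A * x powr p) \<le> Bellman M T p f F k" if "0 \<le> x" "x < w" for x
    proof (cases "B = 0")
      case True
      then show ?thesis using Bellman_ge_at_zero[OF p k f, of F x] A that
        by (simp add: A_def q_def w_def)
    next
      case False
      then show ?thesis
        using Bellman_ge_extremal[OF p k _ B(2) h, of x] B that by (simp add: A_def q_def w_def)
    qed
    have "(\<lambda>n. w * (1 - 1 / real (Suc n))) \<longlonglongrightarrow> w * (1 - 0)"
      using LIMSEQ_inverse_real_of_nat by (intro tendsto_intros) (simp add: inverse_eq_divide)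
    from tendsto_powr[OF this tendsto_const[of p]]
    have "(\<lambda>n. ennreal (A * (w * (1 - 1 / real (Suc n))) powr p)) \<longlonglongrightarrow> ennreal (A * (w * (1 - 0)) powr p)"
      using w by (intro tendsto_ennrealI tendsto_mult_left) auto
    then have "(\<lambda>n. ennreal (A * (w * (1 - 1 / real (Suc n))) powr p)) \<longlonglongrightarrow> ennreal (A * w powr p)"
      by simp
    then have "ennreal (A * w powr p) \<le> Bellman M T p f F k"
    proof (rule LIMSEQ_le_const2)
      have "0 \<le> w * (1 - 1 / real (Suc n))" "w * (1 - 1 / real (Suc n)) < w" for n
        using w by (auto simp: field_simps)
      then show "\<exists>N. \<forall>n\<ge>N. ennreal (A * (w * (1 - 1 / real (Suc n))) powr p) \<le> Bellman M T p f F k"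
        using below by blast
    qed
    then show ?thesis using False by (simp add: cand w_def)
  qed (simp add: cand)
qed

end

theorem theorem1p1:
  fixes M :: "'a measure" and T :: "'a set set" and p f F k :: real
  assumes "prob_space M" and "nonatomic M"
    and "is_tree M T"
    and "p > 1"
    and "0 < f" and "f powr p \<le> F"
    and "0 < k" and "k < 1"
  shows "Bellman M T p f F k =
           (SUP B\<in>{B \<in> {0..f}. h_fun p f k B \<le> F}. ennreal (candidate p f F k B))"
proof -
  obtain C where "maximal_tree M T C"
    using is_tree_imp_maximal_tree assms(1,3) by blast
  then interpret maximal_tree M T C .
  \<comment> \<open>For negative \<open>F\<close> the value \<open>ennreal F\<close> would be 0;
    nonnegativity lets the nonnegative integral be read as the real integral
    \<open>F\<close>.\<close>
  have F0: "0 \<le> F" using assms(6) by (rule order_trans[rotated]) simp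
  show ?thesis
  proof (rule antisym)
    show "(SUP B\<in>{B \<in> {0..f}. h_fun p f k B \<le> F}. ennreal (candidate p f F k B)) \<le> Bellman M T p f F k"
      using assms by (intro SUP_least candidate_le_Bellman) auto
    show "Bellman M T p f F k \<le> (SUP B\<in>{B \<in> {0..f}. h_fun p f k B \<le> F}. ennreal (candidate p f F k B))"
      unfolding Bellman_def
    proof (rule Sup_least)
      fix y assume "y \<in> {(\<integral>\<^sup>+x\<in>K. ennreal_powr (tree_maximal M T \<phi> x) p \<partial>M) | \<phi> K.
            \<phi> \<in> borel_measurable M \<and> (\<forall>x\<in>space M. 0 \<le> \<phi> x) \<and>
            (\<integral>\<^sup>+x. ennreal (\<phi> x) \<partial>M) = ennreal f \<and>
            (\<integral>\<^sup>+x. ennreal (\<phi> x powr p) \<partial>M) = ennreal F \<and>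
            K \<in> sets M \<and> measure M K = k}"
      then obtain \<phi> K where y: "y = (\<integral>\<^sup>+x\<in>K. ennreal_powr (tree_maximal M T \<phi> x) p \<partial>M)"
        and phi [measurable]: "\<phi> \<in> borel_measurable M" and phi0: "\<forall>x\<in>space M. 0 \<le> \<phi> x"
        and int: "(\<integral>\<^sup>+x. ennreal (\<phi> x) \<partial>M) = ennreal f" "(\<integral>\<^sup>+x. ennreal (\<phi> x powr p) \<partial>M) = ennreal F"
        and K: "K \<in> sets M" "measure M K = k" by blast
      have I1: "integrable M \<phi>" "integral\<^sup>L M \<phi> = f"
        using nn_integral_eq_integrable[OF phi, of f] phi0 int(1) assms(5) by auto
      have I2: "integrable M (\<lambda>x. \<phi> x powr p)" "integral\<^sup>L M (\<lambda>x. \<phi> x powr p) = F"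
        using nn_integral_eq_integrable[of "\<lambda>x. \<phi> x powr p" M F] int(2) F0 by auto
      obtain B where "B \<in> {0..f}" "h_fun p f k B \<le> F" "y \<le> ennreal (candidate p f F k B)"
        using maxf_integral_le_candidate[OF phi _ I1(1) assms(4,7,8) _ I2(1) K] phi0 assms(5)
        unfolding I1(2) I2(2) y by blast
      then show "y \<le> (SUP B\<in>{B \<in> {0..f}. h_fun p f k B \<le> F}. ennreal (candidate p f F k B))"
        by (intro SUP_upper2[of B]) auto
    qed
  qed
qed

end
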